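(* Let $f:\mathbb{R}^d\to\mathbb{R}$ satisfy Assumptions A and B (see context), and let $\bar R$ be the constant defined in the context. Run the randomized trust-region method (see context) with noise scale $\sigma\le\bar R$. If at iteration $k$ there is a local minimizer $x^*$ of $f$ with $\|x_k-x^*\|\le\bar R$, then (for every realization of the random draws): (i) stop$_k$ $=$ residual; (ii) iteration $k$ is successful ($\rho_k\ge\rho'$), with $\Delta_{k+1}=\Delta_k$; (iii) $\|x_{k+1}-x^*\|\le\frac{\|x_k-x^*\|^2}{2\bar R}\le\frac{\bar R}2$. Consequently all subsequent iterations satisfy the same assumptions as $k$, and $x_k,x_{k+1},x_{k+2},\dots$ converges at least quadratically to $x^*$.
   Context: Notation: $\|\cdot\|$ is the Euclidean norm, $\|\cdot\|_{\rm op}$ the operator norm. Assumption A: $d\ge3$; $f$ is twice continuously differentiable, $f\ge f_{\mathrm{low}}$ on $\mathbb{R}^d$, $\nabla^2 f$ is $L_H$-Lipschitz ($\|\nabla^2f(x)-\nabla^2f(y)\|_{\rm op}\le L_H\|x-y\|$) and $\nabla f$ is $L_G$-Lipschitz (equivalently $\|\nabla^2f(x)\|_{\rm op}\le L_G$ for all $x$). Assumption B: ($\mu$-Morse, $\mu>0$) for every critical point $\bar x$ of $f$, $\|\nabla^2f(\bar x)u\|\ge\mu\|u\|$ for all $u$; ($(R_s,\gamma_s)$-strong gradient, $R_s,\gamma_s>0$) for every $x\in\mathbb{R}^d$, either $\|\nabla f(x)\|\ge\gamma_s$ or there is a critical point $\bar x$ of $f$ with $\|x-\bar x\|\le R_s$;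 and $R_s\le\frac{\mu^2}{4L_HL_G}$. Boundary gradient step BG$(H,g,\Delta,v)$: let $r=-(Hv+g)$. If $\langle r,Hr\rangle\le0$ or $\|v+\bar\alpha r\|\ge\Delta$ with $\bar\alpha=\|r\|^2/\langle r,Hr\rangle$, output $u=v+s'r$ with $s'\ge0$ such that $\|u\|=\Delta$ (if $r=0$, output $u=v$); otherwise output $u=v+\bar\alpha r$. Subproblem solver tCG-bg$(H,g,\Delta,\xi)$ (parameters $\omega_1\in(0,1)$, $\omega_2>0$; $H$ symmetric $d\times d$, $g,\xi\in\mathbb{R}^d$, $\Delta>0$, $\|\xi\|\le\Delta/4$): set $v^{(0)}=\xi$, $r^{(0)}=-(Hv^{(0)}+g)$, $p^{(0)}=r^{(0)}$. If $r^{(0)}=0$, output $u=v^{(0)}$, stop $=$ residual, $T=0$. For $t=1,2,\dots$: let $\alpha^{(t)}=\|r^{(t-1)}\|^2/\langle p^{(t-1)},Hp^{(t-1)}\rangle$ and $v_+^{(t-1)}=v^{(t-1)}+\alpha^{(t)}p^{(t-1)}$. If $\langle p^{(t-1)},Hp^{(t-1)}\rangle\le0$ or $\|v_+^{(t-1)}\|\ge\Delta/2$, set $v^{(t)}=v^{(t-1)}+sp^{(t-1)}$ with $s\ge0$ such that $\|v^{(t)}\|=\Delta/2$, and output $u=$ BG$(H,g,\Delta,v^{(t)})$, stop $=$ boundary, $T=t$. Otherwise set $v^{(t)}=v_+^{(t-1)}$ and $r^{(t)}=r^{(t-1)}-\alpha^{(t)}Hp^{(t-1)}$; if $\|r^{(t)}\|\le\min(\omega_1\|g\|,\omega_2\|g\|^2)$,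 output $u=v^{(t)}$, stop $=$ residual, $T=t$; else set $\beta^{(t)}=\|r^{(t)}\|^2/\|r^{(t-1)}\|^2$, $p^{(t)}=r^{(t)}+\beta^{(t)}p^{(t-1)}$ and continue. Randomized trust-region method (parameters $\bar\Delta>0$, $0<\rho'<\rho''<1$; input $x_0$, $\Delta_0$, $\sigma$ with $0<4\sigma\le\Delta_0\le\bar\Delta$). For $k=0,1,2,\dots$: let $g_k=\nabla f(x_k)$, $H_k=\nabla^2f(x_k)$, $m_{x_k}(v)=\langle g_k,v\rangle+\frac12\langle v,H_kv\rangle$. Sample $\bar\xi_k$ uniformly on the unit sphere of $\mathbb{R}^d$ (independently of the past) and set $\xi_k=\pm\min(\sigma,\Delta_k/4)\bar\xi_k$ with the sign chosen so that $\langle H_k\xi_k,g_k\rangle\ge0$. Call tCG-bg$(H_k,g_k,\Delta_k,\xi_k)$ to get $u_k$ and stop$_k$. Let $\theta_k=m_{x_k}(\xi_k)-m_{x_k}(0)$ and $\rho_k=\frac{f(x_k)-f(x_k+u_k)+\theta_k}{m_{x_k}(0)-m_{x_k}(u_k)+\theta_k}$. Set $x_{k+1}=x_k+u_k$ if $\rho_k\ge\rho'$ (successful) and $x_{k+1}=x_k$ otherwise. Set $\Delta_{k+1}=\frac14\Delta_k$ if $\rho_k<\rho'$; $\Delta_{k+1}=\min(2\Delta_k,\bar\Delta)$ if $\rho_k>\rho''$ and stop$_k=$ boundary; $\Delta_{k+1}=\Delta_k$ otherwise. Constants: $\Delta_{\rm crit}=\frac{(1-\rho')\mu^2}{10L_HL_G}$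 and $\bar R=\min\!\big(\frac{(1-\rho')\gamma_s}{256L_G},\frac{\mu}{8\omega_2L_G^2},\frac{\Delta_{\rm crit}}{32},\frac{\Delta_0}{8}\big)$. *)

theory Defs
  imports "HOL-Analysis.Analysis" "HOL-Library.While_Combinator"
begin

section \<open>Gradient, Hessian and the class of cost functions\<close>

definition grad :: "(real^'n \<Rightarrow> real) \<Rightarrow> real^'n \<Rightarrow> real^'n" where
  "grad f x = (THE D. GDERIV f x :> D)"

definition hess :: "(real^'n \<Rightarrow> real) \<Rightarrow> real^'n \<Rightarrow> real^'n^'n" where
  "hess f x = jacobian (grad f) (at x)"

definition twice_continuously_differentiable :: "(real^'n \<Rightarrow> real) \<Rightarrow> bool" where
  "twice_continuously_differentiable f \<longleftrightarrow>
     (\<forall>x. f differentiable at x) \<and> (\<forall>x. grad f differentiable at x) \<and>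
     continuous_on UNIV (hess f)"

text \<open>
  The library norm on \<open>real^'n^'n\<close> is the Frobenius norm, so the operator norm is spelled out
  with \<open>onorm\<close>. The constants of the theory divide by \<open>L\<^sub>H\<close> and \<open>L\<^sub>G\<close>, which are therefore positive.
\<close>

definition assumption_A :: "(real^'n \<Rightarrow> real) \<Rightarrow> real \<Rightarrow> real \<Rightarrow> real \<Rightarrow> bool" where
  "assumption_A f f_low L\<^sub>H L\<^sub>G \<longleftrightarrow>
     3 \<le> CARD('n) \<and>
     twice_continuously_differentiable f \<and>
     (\<forall>x. f_low \<le> f x) \<and>
     0 < L\<^sub>H \<and> (\<forall>x y. onorm (\<lambda>w. (hess f x - hess f y) *v w) \<le> L\<^sub>H * norm (x - y)) \<and>
     0 < L\<^sub>G \<and> L\<^sub>G-lipschitz_on UNIV (grad f)"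

definition critical_point :: "(real^'n \<Rightarrow> real) \<Rightarrow> real^'n \<Rightarrow> bool" where
  "critical_point f x \<longleftrightarrow> grad f x = 0"

definition local_minimizer :: "(real^'n \<Rightarrow> real) \<Rightarrow> real^'n \<Rightarrow> bool" where
  "local_minimizer f x \<longleftrightarrow> (\<exists>\<epsilon>>0. \<forall>y\<in>ball x \<epsilon>. f x \<le> f y)"

definition morse :: "real \<Rightarrow> (real^'n \<Rightarrow> real) \<Rightarrow> bool" where
  "morse \<mu> f \<longleftrightarrow>
     (\<forall>xb. critical_point f xb \<longrightarrow> (\<forall>w. \<mu> * norm w \<le> norm (hess f xb *v w)))"

definition strong_gradient :: "real \<Rightarrow> real \<Rightarrow> (real^'n \<Rightarrow> real) \<Rightarrow> bool" where
  "strong_gradient R\<^sub>s \<gamma>\<^sub>s f \<longleftrightarrow>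
     (\<forall>x. \<gamma>\<^sub>s \<le> norm (grad f x) \<or> (\<exists>xb. critical_point f xb \<and> norm (x - xb) \<le> R\<^sub>s))"

definition assumption_B ::
  "(real^'n \<Rightarrow> real) \<Rightarrow> real \<Rightarrow> real \<Rightarrow> real \<Rightarrow> real \<Rightarrow> real \<Rightarrow> bool" where
  "assumption_B f L\<^sub>H L\<^sub>G \<mu> R\<^sub>s \<gamma>\<^sub>s \<longleftrightarrow>
     0 < \<mu> \<and> morse \<mu> f \<and>
     0 < R\<^sub>s \<and> 0 < \<gamma>\<^sub>s \<and> strong_gradient R\<^sub>s \<gamma>\<^sub>s f \<and>
     R\<^sub>s \<le> \<mu>\<^sup>2 / (4 * L\<^sub>H * L\<^sub>G)"


section \<open>Subproblem solver\<close>

text \<open>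
  \<open>to_sphere R v p\<close> is only used with \<open>norm v < R\<close> and \<open>p \<noteq> 0\<close>, where the step length is unique.
\<close>

definition to_sphere :: "real \<Rightarrow> real^'n \<Rightarrow> real^'n \<Rightarrow> real^'n" where
  "to_sphere R v p = v + (SOME s. 0 \<le> s \<and> norm (v + s *\<^sub>R p) = R) *\<^sub>R p"

definition boundary_gradient_step ::
  "real^'n^'n \<Rightarrow> real^'n \<Rightarrow> real \<Rightarrow> real^'n \<Rightarrow> real^'n" where
  "boundary_gradient_step H g \<Delta> v =
    (let r = - (H *v v + g);
         \<alpha> = (norm r)\<^sup>2 / (r \<bullet> (H *v r))
     in if r \<bullet> (H *v r) \<le> 0 \<or> \<Delta> \<le> norm (v + \<alpha> *\<^sub>R r)
        then (if r = 0 then v else to_sphere \<Delta> v r)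
        else v + \<alpha> *\<^sub>R r)"

datatype stop_reason = Residual | Boundary

text \<open>
  \<open>Running t v r p\<close>: iteration \<open>t\<close> is about to start, from the vectors with index \<open>t - 1\<close>.
  \<open>Halted u stop T\<close>: the solver has returned.
\<close>

datatype 'v tcg_state = Running nat 'v 'v 'v | Halted 'v stop_reason nat

fun running :: "'v tcg_state \<Rightarrow> bool" where
  "running (Running t v r p) = True"
| "running (Halted u stop T) = False"

fun solver_output :: "'v tcg_state \<Rightarrow> 'v \<times> stop_reason \<times> nat" where
  "solver_output (Halted u stop T) = (u, stop, T)"
| "solver_output (Running t v r p) = undefined"

definition tcg_init :: "real^'n^'n \<Rightarrow> real^'n \<Rightarrow> real^'n \<Rightarrow> (real^'n) tcg_state" where
  "tcg_init H g \<xi> =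
    (let r = - (H *v \<xi> + g) in if r = 0 then Halted \<xi> Residual 0 else Running 1 \<xi> r r)"

fun tcg_step :: "real \<Rightarrow> real \<Rightarrow> real^'n^'n \<Rightarrow> real^'n \<Rightarrow> real \<Rightarrow>
    (real^'n) tcg_state \<Rightarrow> (real^'n) tcg_state" where
  "tcg_step \<omega>\<^sub>1 \<omega>\<^sub>2 H g \<Delta> (Running t v r p) =
    (let \<alpha> = (norm r)\<^sup>2 / (p \<bullet> (H *v p));
         vp = v + \<alpha> *\<^sub>R p
     in if p \<bullet> (H *v p) \<le> 0 \<or> \<Delta> / 2 \<le> norm vp
        then Halted (boundary_gradient_step H g \<Delta> (to_sphere (\<Delta> / 2) v p)) Boundary t
        else let r' = r - \<alpha> *\<^sub>R (H *v p)
             in if norm r' \<le> min (\<omega>\<^sub>1 * norm g) (\<omega>\<^sub>2 * (norm g)\<^sup>2)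
                then Halted vp Residual t
                else let \<beta> = (norm r')\<^sup>2 / (norm r)\<^sup>2
                     in Running (Suc t) vp r' (r' + \<beta> *\<^sub>R p))"
| "tcg_step \<omega>\<^sub>1 \<omega>\<^sub>2 H g \<Delta> (Halted u stop T) = Halted u stop T"

text \<open>The result is \<open>Some (u, stop, T)\<close>, or \<open>None\<close> if the loop does not terminate.\<close>

definition tcg_bg :: "real \<Rightarrow> real \<Rightarrow> real^'n^'n \<Rightarrow> real^'n \<Rightarrow> real \<Rightarrow> real^'n \<Rightarrow>
    ((real^'n) \<times> stop_reason \<times> nat) option" where
  "tcg_bg \<omega>\<^sub>1 \<omega>\<^sub>2 H g \<Delta> \<xi> =
    map_option solver_output (while_option running (tcg_step \<omega>\<^sub>1 \<omega>\<^sub>2 H g \<Delta>) (tcg_init H g \<xi>))"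


section \<open>Randomized trust-region method\<close>

definition tr_model :: "(real^'n \<Rightarrow> real) \<Rightarrow> real^'n \<Rightarrow> real^'n \<Rightarrow> real" where
  "tr_model f x v = grad f x \<bullet> v + 1/2 * (v \<bullet> (hess f x *v v))"

definition tr_ratio :: "(real^'n \<Rightarrow> real) \<Rightarrow> real^'n \<Rightarrow> real^'n \<Rightarrow> real^'n \<Rightarrow> real" where
  "tr_ratio f x \<xi> u =
    (let \<theta> = tr_model f x \<xi> - tr_model f x 0
     in (f x - f (x + u) + \<theta>) / (tr_model f x 0 - tr_model f x u + \<theta>))"

definition tr_radius ::
  "real \<Rightarrow> real \<Rightarrow> real \<Rightarrow> real \<Rightarrow> real \<Rightarrow> stop_reason \<Rightarrow> real" where
  "tr_radius \<rho>\<^sub>1 \<rho>\<^sub>2 \<Delta>\<^sub>m\<^sub>a\<^sub>x \<Delta> \<rho> stop =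
    (if \<rho> < \<rho>\<^sub>1 then \<Delta> / 4
     else if \<rho>\<^sub>2 < \<rho> \<and> stop = Boundary then min (2 * \<Delta>) \<Delta>\<^sub>m\<^sub>a\<^sub>x
     else \<Delta>)"

text \<open>
  \<open>\<xi>b\<close> is a realization of the random draws: an arbitrary sequence of unit vectors.
  If the solver did not terminate, its output \<open>the None\<close> would be unspecified; in particular,
  being a run does not presuppose that the solver terminates. The parameters
  \<open>\<rho>\<^sub>1\<close>, \<open>\<rho>\<^sub>2\<close>, \<open>\<Delta>\<^sub>m\<^sub>a\<^sub>x\<close> are the thresholds \<open>\<rho>' < \<rho>''\<close> and the maximal radius.
\<close>

definition randomized_tr_run ::
  "(real^'n \<Rightarrow> real) \<Rightarrow> real \<Rightarrow> real \<Rightarrow> real \<Rightarrow> real \<Rightarrow> real \<Rightarrow>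
   real^'n \<Rightarrow> real \<Rightarrow> real \<Rightarrow>
   (nat \<Rightarrow> real^'n) \<Rightarrow> (nat \<Rightarrow> real^'n) \<Rightarrow> (nat \<Rightarrow> real) \<Rightarrow> (nat \<Rightarrow> real^'n) \<Rightarrow>
   (nat \<Rightarrow> real^'n) \<Rightarrow> (nat \<Rightarrow> stop_reason) \<Rightarrow> (nat \<Rightarrow> nat) \<Rightarrow> (nat \<Rightarrow> real) \<Rightarrow> bool" where
  "randomized_tr_run f \<omega>\<^sub>1 \<omega>\<^sub>2 \<rho>\<^sub>1 \<rho>\<^sub>2 \<Delta>\<^sub>m\<^sub>a\<^sub>x x\<^sub>0 \<Delta>\<^sub>0 \<sigma> \<xi>b x \<Delta> \<xi> u stop T \<rho> \<longleftrightarrow>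
     x 0 = x\<^sub>0 \<and> \<Delta> 0 = \<Delta>\<^sub>0 \<and>
     (\<forall>k. norm (\<xi>b k) = 1 \<and>
          (\<xi> k = min \<sigma> (\<Delta> k / 4) *\<^sub>R \<xi>b k \<or> \<xi> k = - (min \<sigma> (\<Delta> k / 4) *\<^sub>R \<xi>b k)) \<and>
          0 \<le> (hess f (x k) *v \<xi> k) \<bullet> grad f (x k) \<and>
          (u k, stop k, T k) =
            the (tcg_bg \<omega>\<^sub>1 \<omega>\<^sub>2 (hess f (x k)) (grad f (x k)) (\<Delta> k) (\<xi> k)) \<and>
          \<rho> k = tr_ratio f (x k) (\<xi> k) (u k) \<and>
          x (Suc k) = (if \<rho>\<^sub>1 \<le> \<rho> k then x k + u k else x k) \<and>
          \<Delta> (Suc k) = tr_radius \<rho>\<^sub>1 \<rho>\<^sub>2 \<Delta>\<^sub>m\<^sub>a\<^sub>x (\<Delta> k) (\<rho> k) (stop k))"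

definition Delta_crit :: "real \<Rightarrow> real \<Rightarrow> real \<Rightarrow> real \<Rightarrow> real" where
  "Delta_crit \<rho>\<^sub>1 \<mu> L\<^sub>H L\<^sub>G = (1 - \<rho>\<^sub>1) * \<mu>\<^sup>2 / (10 * L\<^sub>H * L\<^sub>G)"

definition R_bar :: "real \<Rightarrow> real \<Rightarrow> real \<Rightarrow> real \<Rightarrow> real \<Rightarrow> real \<Rightarrow> real \<Rightarrow> real" where
  "R_bar \<rho>\<^sub>1 \<gamma>\<^sub>s \<mu> \<omega>\<^sub>2 L\<^sub>H L\<^sub>G \<Delta>\<^sub>0 =
     Min {(1 - \<rho>\<^sub>1) * \<gamma>\<^sub>s / (256 * L\<^sub>G),
          \<mu> / (8 * \<omega>\<^sub>2 * L\<^sub>G\<^sup>2),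
          Delta_crit \<rho>\<^sub>1 \<mu> L\<^sub>H L\<^sub>G / 32,
          \<Delta>\<^sub>0 / 8}"

definition converges_at_least_quadratically :: "(nat \<Rightarrow> real^'n) \<Rightarrow> real^'n \<Rightarrow> bool" where
  "converges_at_least_quadratically x l \<longleftrightarrow>
     x \<longlonglongrightarrow> l \<and>
     (\<exists>C. eventually (\<lambda>j. norm (x (Suc j) - l) \<le> C * (norm (x j - l))\<^sup>2) sequentially)"

end

theory Submission
  imports Defs
begin

text \<open>
  The radius never drops below \<open>8 R\<close>: for a small radius, either the gradient is at least \<open>\<gamma>\<^sub>s\<close> and the
  first conjugate gradient step decreases the model enough, or the iterate is close to a critical
  point, the Hessian is uniformly nonsingular, and the first step together with the boundary gradient
  step decreases the model by a multiple of \<open>\<mu>\<^sup>2 / L\<^sub>G\<close> times the squared step length, which dominates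
  the cubic Taylor error; in both cases the step is accepted.

  Within \<open>R\<close> of a local minimizer the Hessian is positive definite and the Newton step has length
  about \<open>R\<close>. The iterates of conjugate gradients move away from \<open>\<xi>\<close> monotonically and stay at most as
  far from it as the Newton step, hence inside the ball of radius \<open>\<Delta> / 2 \<ge> 4 R\<close>. So the solver stops
  on the residual test, and the inexact Newton step with residual at most \<open>\<omega>\<^sub>2 \<parallel>g\<parallel>\<^sup>2\<close> contracts the
  distance to the minimizer quadratically.
\<close>

section \<open>Taylor estimates and second-order conditions\<close>

text \<open>The adjoint of the derivative, applied to 1, represents it as an inner product. That
  vector is unique, so the \<open>THE\<close> in \<open>grad\<close> denotes it.\<close>

lemma GDERIV_grad:
  fixes f :: "real^'n \<Rightarrow> real"
  assumes "f differentiable at x"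
  shows "GDERIV f x :> grad f x"
proof -
  obtain f' where f': "(f has_derivative f') (at x)"
    using assms by (auto simp: differentiable_def)
  define D where "D = adjoint f' 1"
  have "linear f'" using f' has_derivative_linear by blast
  then have "f' = (\<lambda>h. h \<bullet> D)"
    by (auto simp: D_def adjoint_works)
  then have "GDERIV f x :> D"
    using f' by (simp add: gderiv_def)
  moreover have "D = D'" if "GDERIV f x :> D'" for D'
  proof -
    have "(\<lambda>h. h \<bullet> D) = (\<lambda>h. h \<bullet> D')"
      using has_derivative_unique calculation that unfolding gderiv_def by blast
    then show ?thesis by (metis vector_eq_ldot)
  qed
  ultimately show ?thesis
    unfolding grad_def by (metis (mono_tags, lifting) theI)
qed

locale cost =
  fixes f :: "real^'n \<Rightarrow> real" and f_low L\<^sub>H L\<^sub>G :: real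
  assumes A: "assumption_A f f_low L\<^sub>H L\<^sub>G"
begin

lemma L_pos: "0 < L\<^sub>H" "0 < L\<^sub>G"
  using A by (auto simp: assumption_A_def)

lemma has_derivative_grad: "(f has_derivative (\<lambda>h. h \<bullet> grad f x)) (at x)"
  using A GDERIV_grad[of f x]
  by (auto simp: assumption_A_def twice_continuously_differentiable_def gderiv_def)

lemma has_derivative_hess: "(grad f has_derivative (\<lambda>h. hess f x *v h)) (at x)"
  using A jacobian_works[of "grad f" "at x"]
  by (auto simp: assumption_A_def twice_continuously_differentiable_def hess_def)

lemma grad_lipschitz: "norm (grad f x - grad f y) \<le> L\<^sub>G * norm (x - y)"
  using A by (auto simp: assumption_A_def lipschitz_on_def dist_norm)

lemma hess_lipschitz:
  "norm (hess f x *v w - hess f y *v w) \<le> L\<^sub>H * norm (x - y) * norm w"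
proof -
  have "norm ((hess f x - hess f y) *v w)
    \<le> onorm (\<lambda>w. (hess f x - hess f y) *v w) * norm w"
    by (rule onorm) (rule matrix_vector_mul_bounded_linear)
  also have "\<dots> \<le> L\<^sub>H * norm (x - y) * norm w"
    using A by (intro mult_right_mono) (auto simp: assumption_A_def)
  finally show ?thesis by (simp add: matrix_vector_mult_diff_rdistrib)
qed

section \<open>Taylor bounds from the Lipschitz constants\<close>

lemma deriv_f_line:
  "((\<lambda>t. f (x + t *\<^sub>R u)) has_real_derivative grad f (x + t *\<^sub>R u) \<bullet> u) (at t)"
proof -
  have "((\<lambda>t. x + t *\<^sub>R u) has_derivative (\<lambda>t. t *\<^sub>R u)) (at t)"
    by (auto intro!: derivative_eq_intros)
  from has_derivative_compose[OF this has_derivative_grad]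
  show ?thesis
    by (simp add: has_field_derivative_def inner_commute mult.commute[of _ "_ \<bullet> _"])
qed

lemma deriv_grad_line:
  "((\<lambda>t. grad f (x + t *\<^sub>R u) \<bullet> w) has_real_derivative (hess f (x + t *\<^sub>R u) *v u) \<bullet> w) (at t)"
proof -
  have "((\<lambda>t. x + t *\<^sub>R u) has_derivative (\<lambda>t. t *\<^sub>R u)) (at t)"
    by (auto intro!: derivative_eq_intros)
  from has_derivative_inner_left[OF has_derivative_compose[OF this has_derivative_hess], of w]
  show ?thesis
    by (simp add: has_field_derivative_def matrix_vector_mult_scaleR mult.commute[of _ "_ \<bullet> _"])
qed

text \<open>Pair the difference quotients of the gradient along \<open>w\<close> with the vector
  \<open>hess f x *v w\<close> itself: Cauchy-Schwarz and the Lipschitz gradient bound them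
  uniformly, and their limit is the squared norm of that vector.\<close>

lemma hess_norm_le: "norm (hess f x *v w) \<le> L\<^sub>G * norm w"
proof -
  let ?a = "hess f x *v w"
  have lim: "((\<lambda>t. (grad f (x + t *\<^sub>R w) \<bullet> ?a - grad f (x + 0 *\<^sub>R w) \<bullet> ?a) / (t - 0)) \<longlongrightarrow> ?a \<bullet> ?a) (at 0)"
    using deriv_grad_line[of x w ?a 0] unfolding has_field_derivative_iff by simp
  have "(grad f (x + t *\<^sub>R w) \<bullet> ?a - grad f (x + 0 *\<^sub>R w) \<bullet> ?a) / (t - 0)
    \<le> L\<^sub>G * norm w * norm ?a" for t
  proof -
    have "\<bar>(grad f (x + t *\<^sub>R w) - grad f x) \<bullet> ?a\<bar> \<le> norm (grad f (x + t *\<^sub>R w) - grad f x) * norm ?a"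
      by (rule Cauchy_Schwarz_ineq2)
    also have "\<dots> \<le> (L\<^sub>G * norm (x + t *\<^sub>R w - x)) * norm ?a"
      by (intro mult_right_mono grad_lipschitz) auto
    finally have "\<bar>((grad f (x + t *\<^sub>R w) - grad f x) \<bullet> ?a) / t\<bar> \<le> L\<^sub>G * norm w * norm ?a"
      using L_pos by (cases "t = 0") (auto simp: field_simps)
    then have "(grad f (x + t *\<^sub>R w) - grad f x) \<bullet> ?a / t \<le> L\<^sub>G * norm w * norm ?a"
      by (rule order_trans[OF abs_ge_self])
    then show ?thesis by (simp add: inner_diff_left)
  qed
  then have "?a \<bullet> ?a \<le> L\<^sub>G * norm w * norm ?a"
    by (intro tendsto_upperbound[OF lim] always_eventually allI) auto
  then have "norm ?a * norm ?a \<le> L\<^sub>G * norm w * norm ?a"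
    by (metis power2_norm_eq_inner power2_eq_square)
  then show ?thesis
    using L_pos by (cases "norm ?a = 0") auto
qed

lemma f_upper: "f (x + u) - f x - grad f x \<bullet> u \<le> L\<^sub>G / 2 * (norm u)\<^sup>2"
proof -
  define \<psi> where "\<psi> t = f (x + t *\<^sub>R u) - t * (grad f x \<bullet> u) - L\<^sub>G / 2 * (norm u)\<^sup>2 * t\<^sup>2" for t
  have "\<psi> 1 \<le> \<psi> 0"
  proof (rule DERIV_nonpos_imp_nonincreasing[where f = \<psi>])
    fix t :: real assume t: "0 \<le> t" "t \<le> 1"
    have "(\<psi> has_real_derivative (grad f (x + t *\<^sub>R u) \<bullet> u - grad f x \<bullet> u - L\<^sub>G * (norm u)\<^sup>2 * t)) (at t)"
      unfolding \<psi>_def by (auto intro!: derivative_eq_intros deriv_f_line)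
    moreover have "grad f (x + t *\<^sub>R u) \<bullet> u - grad f x \<bullet> u \<le> L\<^sub>G * (norm u)\<^sup>2 * t"
    proof -
      have "(grad f (x + t *\<^sub>R u) - grad f x) \<bullet> u \<le> norm (grad f (x + t *\<^sub>R u) - grad f x) * norm u"
        by (rule norm_cauchy_schwarz)
      also have "\<dots> \<le> (L\<^sub>G * norm (x + t *\<^sub>R u - x)) * norm u"
        by (intro mult_right_mono grad_lipschitz) auto
      finally show ?thesis using t by (simp add: inner_diff_left power2_eq_square algebra_simps)
    qed
    ultimately show "\<exists>y. (\<psi> has_real_derivative y) (at t) \<and> y \<le> 0" by (metis diff_le_0_iff_le)
  qed simp
  then show ?thesis by (simp add: \<psi>_def)
qed

text \<open>One-sided, because only an excess of \<open>f\<close> over the model lowers the ratio.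
  The Lipschitz bound on the Hessian is integrated twice.\<close>

lemma tr_model_error_cubic:
  "f (x + u) - f x - tr_model f x u \<le> L\<^sub>H / 6 * norm u ^ 3"
proof -
  define \<psi> where "\<psi> t = f (x + t *\<^sub>R u) - t * (grad f x \<bullet> u)
    - t\<^sup>2 / 2 * (u \<bullet> (hess f x *v u)) - L\<^sub>H / 6 * norm u ^ 3 * t ^ 3" for t
  \<comment> \<open>\<open>\<psi>'\<close> is the derivative of \<open>\<psi>\<close>; it vanishes
    at 0 and is itself nonincreasing for nonnegative arguments.\<close>
  define \<psi>' where "\<psi>' t = grad f (x + t *\<^sub>R u) \<bullet> u - grad f x \<bullet> u
    - t * (u \<bullet> (hess f x *v u)) - L\<^sub>H / 2 * norm u ^ 3 * t\<^sup>2" for t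
  have \<psi>'_le: "\<psi>' t \<le> 0" if "0 \<le> t" for t
  proof -
    have "\<psi>' t \<le> \<psi>' 0"
    proof (rule DERIV_nonpos_imp_nonincreasing[OF that])
      fix s :: real assume s: "0 \<le> s" "s \<le> t"
      have "(\<psi>' has_real_derivative ((hess f (x + s *\<^sub>R u) *v u) \<bullet> u
          - u \<bullet> (hess f x *v u) - L\<^sub>H * norm u ^ 3 * s)) (at s)"
        unfolding \<psi>'_def by (auto intro!: derivative_eq_intros deriv_grad_line)
      moreover have "(hess f (x + s *\<^sub>R u) *v u) \<bullet> u - u \<bullet> (hess f x *v u) \<le> L\<^sub>H * norm u ^ 3 * s"
      proof -
        have "(hess f (x + s *\<^sub>R u) *v u - hess f x *v u) \<bullet> u
          \<le> norm (hess f (x + s *\<^sub>R u) *v u - hess f x *v u) * norm u"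
          by (rule norm_cauchy_schwarz)
        also have "\<dots> \<le> (L\<^sub>H * norm (x + s *\<^sub>R u - x) * norm u) * norm u"
          by (intro mult_right_mono hess_lipschitz) auto
        finally show ?thesis
          using s by (simp add: inner_diff_left inner_commute power3_eq_cube algebra_simps)
      qed
      ultimately show "\<exists>y. (\<psi>' has_real_derivative y) (at s) \<and> y \<le> 0"
        by (metis diff_le_0_iff_le)
    qed
    then show ?thesis by (simp add: \<psi>'_def)
  qed
  have "\<psi> 1 \<le> \<psi> 0"
  proof (rule DERIV_nonpos_imp_nonincreasing[where f = \<psi>])
    fix t :: real assume t: "0 \<le> t" "t \<le> 1"
    have "(\<psi> has_real_derivative \<psi>' t) (at t)"
      unfolding \<psi>_def \<psi>'_def by (auto intro!: derivative_eq_intros deriv_f_line)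
    then show "\<exists>y. (\<psi> has_real_derivative y) (at t) \<and> y \<le> 0" using \<psi>'_le t by blast
  qed simp
  then show ?thesis by (simp add: \<psi>_def tr_model_def)
qed

text \<open>Mean value inequality for \<open>grad f y - hess f z *v y\<close> on a ball around
  \<open>z\<close>, where its derivative has norm at most \<open>L\<^sub>H * r\<close>. The centre
  may differ from both endpoints.\<close>

lemma grad_linearization:
  assumes "norm (y - z) \<le> r" "norm (y' - z) \<le> r"
  shows "norm (grad f y' - grad f y - hess f z *v (y' - y)) \<le> L\<^sub>H * r * norm (y' - y)"
proof -
  have "norm ((grad f y' - hess f z *v y') - (grad f y - hess f z *v y)) \<le> L\<^sub>H * r * norm (y' - y)"
  proof (rule differentiable_bound[where S = "cball z r"])
    show "((\<lambda>y. grad f y - hess f z *v y) has_derivative (\<lambda>h. hess f a *v h - hess f z *v h)) (at a within cball z r)" for a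
      by (intro derivative_intros has_derivative_at_withinI[OF has_derivative_hess]
        has_derivative_at_withinI[OF bounded_linear_imp_has_derivative] matrix_vector_mul_bounded_linear)
    show "onorm (\<lambda>h. hess f a *v h - hess f z *v h) \<le> L\<^sub>H * r" if "a \<in> cball z r" for a
    proof (rule onorm_le)
      fix h
      have "norm (hess f a *v h - hess f z *v h) \<le> L\<^sub>H * norm (a - z) * norm h"
        by (rule hess_lipschitz)
      also have "\<dots> \<le> L\<^sub>H * r * norm h"
        using that L_pos by (intro mult_right_mono mult_left_mono) (auto simp: dist_norm norm_minus_commute)
      finally show "norm (hess f a *v h - hess f z *v h) \<le> L\<^sub>H * r * norm h" .
    qed
  qed (use assms in \<open>auto simp: dist_norm norm_minus_commute\<close>)
  then show ?thesis by (simp add: algebra_simps matrix_vector_mult_diff_distrib)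
qed

section \<open>Symmetry of the Hessian\<close>

lemma second_difference:
  "\<bar>f (x + u + v) - f (x + u) - f (x + v) + f x - (hess f x *v u) \<bullet> v\<bar>
    \<le> L\<^sub>H * (norm u + norm v) * norm u * norm v"
proof -
  define \<phi> where "\<phi> t = f (x + u + t *\<^sub>R v) - f (x + t *\<^sub>R v)" for t
  have "\<exists>t. 0 < t \<and> t < 1 \<and> \<phi> 1 - \<phi> 0 =
      (1 - 0) * (grad f (x + u + t *\<^sub>R v) \<bullet> v - grad f (x + t *\<^sub>R v) \<bullet> v)"
    by (rule MVT2) (auto simp: \<phi>_def intro!: derivative_eq_intros deriv_f_line)
  then obtain t where t: "0 < t" "t < 1"
    and eq: "\<phi> 1 - \<phi> 0 = (grad f (x + u + t *\<^sub>R v) - grad f (x + t *\<^sub>R v)) \<bullet> v"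
    by (auto simp: inner_diff_left)
  have n: "norm (t *\<^sub>R v) \<le> norm v" using t by (simp add: mult_left_le_one_le)
  have "norm (grad f (x + u + t *\<^sub>R v) - grad f (x + t *\<^sub>R v) - hess f x *v (x + u + t *\<^sub>R v - (x + t *\<^sub>R v)))
     \<le> L\<^sub>H * (norm u + norm v) * norm (x + u + t *\<^sub>R v - (x + t *\<^sub>R v))"
  proof (rule grad_linearization)
    show "norm (x + t *\<^sub>R v - x) \<le> norm u + norm v"
      using n by (simp add: add_increasing)
    have "norm (u + t *\<^sub>R v) \<le> norm u + norm v"
      using n norm_triangle_ineq[of u "t *\<^sub>R v"] by linarith
    then show "norm (x + u + t *\<^sub>R v - x) \<le> norm u + norm v"
      by (simp add: algebra_simps)
  qed
  then have "norm (grad f (x + u + t *\<^sub>R v) - grad f (x + t *\<^sub>R v) - hess f x *v u) * norm v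
     \<le> L\<^sub>H * (norm u + norm v) * norm u * norm v"
    by (intro mult_right_mono) auto
  moreover have "\<bar>(grad f (x + u + t *\<^sub>R v) - grad f (x + t *\<^sub>R v) - hess f x *v u) \<bullet> v\<bar>
    \<le> norm (grad f (x + u + t *\<^sub>R v) - grad f (x + t *\<^sub>R v) - hess f x *v u) * norm v"
    by (rule Cauchy_Schwarz_ineq2)
  moreover have "f (x + u + v) - f (x + u) - f (x + v) + f x - (hess f x *v u) \<bullet> v
    = (grad f (x + u + t *\<^sub>R v) - grad f (x + t *\<^sub>R v) - hess f x *v u) \<bullet> v"
    using eq by (simp add: \<phi>_def inner_diff_left)
  ultimately show ?thesis by linarith
qed

text \<open>Both pairings approximate the same second difference. When \<open>u\<close> and
  \<open>v\<close> are scaled by \<epsilon>, the pairings scale with the square of \<epsilon> and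
  the errors with its cube.\<close>

lemma hess_symmetric: "(hess f x *v u) \<bullet> v = u \<bullet> (hess f x *v v)"
proof (rule ccontr)
  define \<delta> where "\<delta> = \<bar>(hess f x *v u) \<bullet> v - u \<bullet> (hess f x *v v)\<bar>"
  define C where "C = 2 * (L\<^sub>H * (norm u + norm v) * norm u * norm v)"
  assume "\<not> ?thesis"
  then have "0 < \<delta>" by (simp add: \<delta>_def)
  have "0 \<le> C" using L_pos by (simp add: C_def)
  have le: "\<delta> \<le> C * \<epsilon>" if "0 < \<epsilon>" for \<epsilon>
  proof -
    note a = second_difference[of x "\<epsilon> *\<^sub>R u" "\<epsilon> *\<^sub>R v"]
    note b = second_difference[of x "\<epsilon> *\<^sub>R v" "\<epsilon> *\<^sub>R u"]
    let ?X = "(hess f x *v (\<epsilon> *\<^sub>R u)) \<bullet> (\<epsilon> *\<^sub>R v)" and ?Y = "(hess f x *v (\<epsilon> *\<^sub>R v)) \<bullet> (\<epsilon> *\<^sub>R u)"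
    let ?D = "f (x + \<epsilon> *\<^sub>R u + \<epsilon> *\<^sub>R v) - f (x + \<epsilon> *\<^sub>R u) - f (x + \<epsilon> *\<^sub>R v) + f x"
    have "\<bar>?D - ?X\<bar> \<le> \<epsilon> ^ 3 * C / 2"
      using a that by (simp add: C_def power3_eq_cube algebra_simps)
    moreover have "\<bar>?D - ?Y\<bar> \<le> \<epsilon> ^ 3 * C / 2"
      using b that by (simp add: C_def power3_eq_cube algebra_simps)
    ultimately have le: "\<bar>?X - ?Y\<bar> \<le> \<epsilon> ^ 3 * C" by linarith
    have "?X - ?Y = \<epsilon>\<^sup>2 * ((hess f x *v u) \<bullet> v - u \<bullet> (hess f x *v v))"
      by (simp add: matrix_vector_mult_scaleR inner_commute power2_eq_square algebra_simps)
    then have "\<bar>?X - ?Y\<bar> = \<epsilon>\<^sup>2 * \<delta>"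
      by (simp add: \<delta>_def abs_mult)
    with le have "\<epsilon>\<^sup>2 * \<delta> \<le> \<epsilon>\<^sup>2 * (C * \<epsilon>)"
      by (simp add: power2_eq_square power3_eq_cube algebra_simps)
    then show ?thesis using that by simp
  qed
  \<comment> \<open>This choice of \<epsilon> makes \<open>C * \<epsilon>\<close> at most half of
    \<delta>.\<close>
  have "\<delta> \<le> C * (\<delta> / (2 * (C + 1)))"
    using \<open>0 < \<delta>\<close> \<open>0 \<le> C\<close> by (intro le) auto
  then have "\<delta> * (2 * (C + 1)) \<le> C * \<delta>"
    using \<open>0 \<le> C\<close> by (simp add: field_simps)
  then have "\<delta> * (C + 2) \<le> 0" by (simp add: algebra_simps)
  then show False using \<open>0 < \<delta>\<close> \<open>0 \<le> C\<close> by (simp add: mult_le_0_iff)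
qed

section \<open>Necessary conditions at a local minimizer\<close>

lemma local_minimizer_small_steps:
  assumes "local_minimizer f xs"
  obtains \<epsilon> where "0 < \<epsilon>" "\<And>t. 0 < t \<Longrightarrow> t < \<epsilon> \<Longrightarrow> f xs \<le> f (xs + t *\<^sub>R w)"
proof -
  obtain \<epsilon> where \<epsilon>: "0 < \<epsilon>" "\<And>y. y \<in> ball xs \<epsilon> \<Longrightarrow> f xs \<le> f y"
    using assms by (auto simp: local_minimizer_def)
  show thesis
  proof
    \<comment> \<open>The added 1 covers \<open>w = 0\<close>.\<close>
    show "0 < \<epsilon> / (norm w + 1)" using \<epsilon> by (simp add: add_nonneg_pos)
    fix t :: real assume t: "0 < t" "t < \<epsilon> / (norm w + 1)"
    have "t * norm w \<le> t * (norm w + 1)" using t by simp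
    also have "\<dots> < \<epsilon>" using t by (simp add: pos_less_divide_eq add_nonneg_pos)
    finally show "f xs \<le> f (xs + t *\<^sub>R w)"
      using t by (intro \<epsilon>) (simp add: dist_norm)
  qed
qed

lemma grad_local_minimizer:
  assumes "local_minimizer f xs"
  shows "grad f xs = 0"
proof (rule ccontr)
  define g where "g = grad f xs"
  assume "grad f xs \<noteq> 0"
  then have g: "0 < (norm g)\<^sup>2" by (simp add: g_def)
  obtain \<epsilon> where \<epsilon>: "0 < \<epsilon>" "\<And>t. 0 < t \<Longrightarrow> t < \<epsilon> \<Longrightarrow> f xs \<le> f (xs + t *\<^sub>R (- g))"
    using local_minimizer_small_steps[OF assms] by metis
  \<comment> \<open>With \<open>L\<^sub>G * t \<le> 1\<close> the linear loss along
    \<open>- g\<close> is at least twice the quadratic term of \<open>f_upper\<close>.\<close>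
  define t where "t = min (\<epsilon> / 2) (1 / L\<^sub>G)"
  have t: "0 < t" "t < \<epsilon>" "L\<^sub>G * t \<le> 1"
    using \<epsilon> L_pos by (auto simp: t_def min_def field_simps)
  have "0 \<le> t * (g \<bullet> (- g)) + L\<^sub>G / 2 * (t\<^sup>2 * (norm g)\<^sup>2)"
    using \<epsilon>(2)[OF t(1,2)] f_upper[of xs "t *\<^sub>R (- g)"]
    by (simp add: g_def power_mult_distrib)
  also have "\<dots> = t * (norm g)\<^sup>2 * (L\<^sub>G * t / 2 - 1)"
    by (simp add: power2_norm_eq_inner[symmetric] power2_eq_square[of t] algebra_simps)
  also have "\<dots> < 0" using t g by (intro mult_pos_neg) auto
  finally show False by simp
qed

lemma hess_local_minimizer_psd:
  assumes "local_minimizer f xs"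
  shows "0 \<le> w \<bullet> (hess f xs *v w)"
proof (rule ccontr)
  define a where "a = - (w \<bullet> (hess f xs *v w))"
  define b where "b = L\<^sub>H / 3 * norm w ^ 3"
  assume "\<not> ?thesis"
  then have a: "0 < a" by (simp add: a_def)
  have b: "0 \<le> b" using L_pos by (simp add: b_def)
  obtain \<epsilon> where \<epsilon>: "0 < \<epsilon>" "\<And>t. 0 < t \<Longrightarrow> t < \<epsilon> \<Longrightarrow> f xs \<le> f (xs + t *\<^sub>R w)"
    using local_minimizer_small_steps[OF assms] by metis
  \<comment> \<open>Small enough that the cubic remainder, \<open>t\<^sup>2 / 2 * (t * b)\<close>,
    stays below the loss \<open>t\<^sup>2 / 2 * a\<close> caused by negative curvature.\<close>
  define t where "t = min (\<epsilon> / 2) (a / (2 * (b + 1)))"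
  have t: "0 < t" "t < \<epsilon>" using \<epsilon> a b by (auto simp: t_def)
  have "t * (b + 1) \<le> a / 2"
  proof -
    have "t \<le> a / (2 * (b + 1))" by (simp add: t_def)
    then show ?thesis using b by (simp add: field_simps)
  qed
  have "0 \<le> - (t\<^sup>2 * a / 2) + L\<^sub>H / 6 * (t ^ 3 * norm w ^ 3)"
    using \<epsilon>(2)[OF t] tr_model_error_cubic[of xs "t *\<^sub>R w"] grad_local_minimizer[OF assms] t
    by (simp add: tr_model_def a_def power_mult_distrib matrix_vector_mult_scaleR power2_eq_square)
  also have "\<dots> = t\<^sup>2 / 2 * (t * b - a)"
    by (simp add: b_def power2_eq_square power3_eq_cube algebra_simps)
  finally have "a \<le> t * b" using t by (simp add: zero_le_mult_iff)
  then show False using \<open>t * (b + 1) \<le> a / 2\<close> t a by (simp add: algebra_simps)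
qed

text \<open>A proof without eigenvalues: write \<open>w\<close> as the image of \<open>z\<close>
  under the Hessian and test semidefiniteness at \<open>z - (1 / \<mu>) *\<^sub>R w\<close>. The
  Morse bound on \<open>z\<close> controls \<open>w \<bullet> z\<close>, and the claim
  remains.\<close>

lemma hess_local_minimizer_pd:
  assumes "local_minimizer f xs" "morse \<mu> f" "0 < \<mu>"
  shows "\<mu> * (norm w)\<^sup>2 \<le> w \<bullet> (hess f xs *v w)"
proof -
  let ?H = "\<lambda>w. hess f xs *v w"
  have m: "\<mu> * norm w \<le> norm (?H w)" for w
    using assms grad_local_minimizer[OF assms(1)] by (simp add: morse_def critical_point_def)
  have "inj ?H"
  proof (rule injI)
    fix a b assume "?H a = ?H b"
    then have "\<mu> * norm (a - b) \<le> 0"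
      using m[of "a - b"] by (simp add: matrix_vector_mult_diff_distrib)
    then show "a = b" using assms(3) by (simp add: mult_le_0_iff)
  qed
  then have "surj ?H" by (intro linear_injective_imp_surjective[OF matrix_vector_mul_linear]) auto
  then obtain z where z: "w = ?H z" by (meson surjD)
  have zn: "norm z \<le> norm w / \<mu>" using m[of z] z assms(3) by (simp add: field_simps)
  let ?a = "w \<bullet> ?H w"
  show ?thesis
  proof (cases "w = 0")
    case False
    have wz: "w \<bullet> z \<le> (norm w)\<^sup>2 / \<mu>"
      using norm_cauchy_schwarz[of w z] mult_left_mono[OF zn, of "norm w"] 
      by (simp add: power2_eq_square)
    have *: "0 \<le> w \<bullet> z + 2 * s * (norm w)\<^sup>2 + s\<^sup>2 * ?a" for s
    proof -
      have "0 \<le> (z + s *\<^sub>R w) \<bullet> ?H (z + s *\<^sub>R w)"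
        by (rule hess_local_minimizer_psd[OF assms(1)])
      also have "\<dots> = z \<bullet> w + s * (z \<bullet> ?H w) + s * (w \<bullet> w) + s\<^sup>2 * ?a"
        by (simp add: matrix_vector_right_distrib matrix_vector_mult_scaleR inner_add_left
          inner_add_right z[symmetric] algebra_simps power2_eq_square)
      also have "z \<bullet> ?H w = w \<bullet> w" using hess_symmetric[of xs z w] z by simp
      finally show ?thesis by (simp add: power2_norm_eq_inner inner_commute algebra_simps)
    qed
    have "0 \<le> w \<bullet> z + 2 * (-1/\<mu>) * (norm w)\<^sup>2 + (-1/\<mu>)\<^sup>2 * ?a" by (rule *)
    then have "(norm w)\<^sup>2 / \<mu> \<le> ?a / \<mu>\<^sup>2" using wz by (simp add: power_divide)
    then show ?thesis using assms(3) by (simp add: field_simps power2_eq_square)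
  qed simp
qed

end

section \<open>Conjugate gradients on the subproblem\<close>

text \<open>Existence is the intermediate value theorem. Minimality of the step length is convexity
  of the norm: from a start strictly inside, the segment stays strictly inside until its endpoint on
  the sphere.\<close>

lemma to_sphere_step:
  fixes v p :: "real^'n"
  assumes "norm v < B" "p \<noteq> 0"
  obtains s where "0 \<le> s" "to_sphere B v p = v + s *\<^sub>R p" "norm (v + s *\<^sub>R p) = B"
    "\<And>a. 0 \<le> a \<Longrightarrow> B \<le> norm (v + a *\<^sub>R p) \<Longrightarrow> s \<le> a"
proof -
  \<comment> \<open>By the triangle inequality the point at parameter \<open>b\<close> has norm at
    least \<open>B\<close>.\<close>
  define b where "b = (B + norm v) / norm p"
  have "0 \<le> B + norm v" using assms norm_ge_zero[of v] by linarith
  then have b: "0 \<le> b" "b * norm p = B + norm v"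
    using assms by (auto simp: b_def)
  have "B \<le> norm (v + b *\<^sub>R p)"
    using norm_triangle_ineq2[of "b *\<^sub>R p" "- v"] b by (simp add: add.commute)
  moreover have "continuous_on {0..b} (\<lambda>s. norm (v + s *\<^sub>R p))"
    by (intro continuous_intros)
  ultimately have "\<exists>s. 0 \<le> s \<and> s \<le> b \<and> norm (v + s *\<^sub>R p) = B"
    using assms b by (intro IVT') auto
  then have ex: "\<exists>s. 0 \<le> s \<and> norm (v + s *\<^sub>R p) = B" by blast
  define s where "s = (SOME s. 0 \<le> s \<and> norm (v + s *\<^sub>R p) = B)"
  have s: "0 \<le> s" "norm (v + s *\<^sub>R p) = B"
    using someI_ex[OF ex] by (auto simp: s_def)
  show thesis
  proof (rule that)
    fix a :: real assume a: "0 \<le> a" "B \<le> norm (v + a *\<^sub>R p)"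
    show "s \<le> a"
    proof (rule ccontr)
      assume "\<not> s \<le> a"
      define c where "c = a / s"
      have c: "0 \<le> c" "c < 1" "a = c * s" using \<open>\<not> s \<le> a\<close> a by (auto simp: c_def)
      have "v + a *\<^sub>R p = (1 - c) *\<^sub>R v + c *\<^sub>R (v + s *\<^sub>R p)"
        by (simp add: c(3) algebra_simps)
      then have "norm (v + a *\<^sub>R p) \<le> norm ((1 - c) *\<^sub>R v) + norm (c *\<^sub>R (v + s *\<^sub>R p))"
        by (metis norm_triangle_ineq)
      also have "\<dots> = (1 - c) * norm v + c * B"
        by (simp only: norm_scaleR abs_of_nonneg c(1) s(2) less_imp_le[OF c(2)] diff_ge_0_iff_ge)
      also have "\<dots> < (1 - c) * B + c * B" using c assms by simp
      finally show False using a by (simp add: algebra_simps)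
    qed
  qed (use s in \<open>auto simp: to_sphere_def s_def\<close>)
qed

text \<open>Turns a lower bound \<open>a\<close> on a residual norm \<open>x\<close> into a lower
  bound on the Cauchy decrease.\<close>

lemma half_mult_min_ge:
  fixes a x b L :: real
  assumes "0 \<le> a" "a \<le> x" "0 < L" "a / L \<le> b"
  shows "a\<^sup>2 / (2 * L) \<le> x * min (x / L) b / 2"
proof -
  have "a * (a / L) \<le> x * min (x / L) b"
    using assms by (intro mult_mono) (auto simp: divide_right_mono)
  then show ?thesis by (simp add: power2_eq_square)
qed

locale subproblem =
  fixes H :: "real^'n^'n" and g \<xi> :: "real^'n" and \<Delta> L :: real
  assumes sym: "\<And>a b. (H *v a) \<bullet> b = a \<bullet> (H *v b)"
    and bound: "\<And>w. norm (H *v w) \<le> L * norm w"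
    and L_pos: "0 < L" and \<Delta>_pos: "0 < \<Delta>"
    and start: "norm \<xi> \<le> \<Delta> / 4" and angle: "0 \<le> (H *v \<xi>) \<bullet> g"
begin

definition q :: "real^'n \<Rightarrow> real" where
  "q v = g \<bullet> v + 1/2 * (v \<bullet> (H *v v))"

text \<open>The negative gradient of \<open>q\<close>; its zeros are the Newton steps.\<close>

definition res :: "real^'n \<Rightarrow> real^'n" where
  "res v = - (H *v v + g)"

lemma curv_le: "w \<bullet> (H *v w) \<le> L * (norm w)\<^sup>2"
proof -
  have "w \<bullet> (H *v w) \<le> norm w * norm (H *v w)" by (rule norm_cauchy_schwarz)
  also have "\<dots> \<le> norm w * (L * norm w)" by (intro mult_left_mono bound) auto
  finally show ?thesis by (simp add: power2_eq_square algebra_simps)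
qed

lemma res_step: "res (v + s *\<^sub>R p) = res v - s *\<^sub>R (H *v p)"
  by (simp add: res_def matrix_vector_right_distrib matrix_vector_mult_scaleR)

lemma q_step: "q v - q (v + s *\<^sub>R p) = s * (p \<bullet> res v) - s\<^sup>2 / 2 * (p \<bullet> (H *v p))"
proof -
  have "p \<bullet> (H *v v) = v \<bullet> (H *v p)" using sym[of p v] by (simp add: inner_commute)
  then show ?thesis
    by (simp add: q_def res_def matrix_vector_right_distrib matrix_vector_mult_scaleR
        inner_add_left inner_add_right inner_commute[of g p] power2_eq_square algebra_simps)
qed

text \<open>Exact minimization along \<open>p\<close>. The first hypothesis holds for conjugate
  gradient directions and for \<open>p = res v\<close>, so both kinds of step share the
  lemma.\<close>

lemma interior_step_decrease:
  assumes "p \<bullet> res v = (norm (res v))\<^sup>2" "0 < p \<bullet> (H *v p)"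
  defines "\<alpha> \<equiv> (norm (res v))\<^sup>2 / (p \<bullet> (H *v p))"
  shows "q v - q (v + \<alpha> *\<^sub>R p) = \<alpha> * (norm (res v))\<^sup>2 / 2"
proof -
  have "\<alpha> * (p \<bullet> (H *v p)) = (norm (res v))\<^sup>2" using assms(2) by (simp add: \<alpha>_def)
  then have "\<alpha>\<^sup>2 * (p \<bullet> (H *v p)) = \<alpha> * (norm (res v))\<^sup>2" by (simp add: power2_eq_square)
  then show ?thesis using assms(1) by (simp add: q_step)
qed

text \<open>Under positive curvature the sphere is met no later than the exact line minimizer, so
  the quadratic term consumes at most half of the linear gain; otherwise it consumes
  nothing.\<close>

lemma boundary_step_decrease:
  assumes "norm v < B" "p \<bullet> res v = (norm (res v))\<^sup>2" "res v \<noteq> 0"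
    and exit: "p \<bullet> (H *v p) \<le> 0 \<or> B \<le> norm (v + ((norm (res v))\<^sup>2 / (p \<bullet> (H *v p))) *\<^sub>R p)"
  obtains s where "0 \<le> s" "to_sphere B v p = v + s *\<^sub>R p" "norm (v + s *\<^sub>R p) = B"
    "s * (norm (res v))\<^sup>2 / 2 \<le> q v - q (v + s *\<^sub>R p)"
proof -
  have "p \<noteq> 0" using assms(2,3) by auto
  then obtain s where s: "0 \<le> s" "to_sphere B v p = v + s *\<^sub>R p" "norm (v + s *\<^sub>R p) = B"
    "\<And>a. 0 \<le> a \<Longrightarrow> B \<le> norm (v + a *\<^sub>R p) \<Longrightarrow> s \<le> a"
    using to_sphere_step assms(1) by metis
  have "s * (p \<bullet> (H *v p)) \<le> (norm (res v))\<^sup>2"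
  proof (cases "p \<bullet> (H *v p) \<le> 0")
    case True
    then have "s * (p \<bullet> (H *v p)) \<le> 0" using s(1) by (simp add: mult_nonneg_nonpos)
    then show ?thesis by (meson order_trans zero_le_power2)
  next
    case False
    then have "s \<le> (norm (res v))\<^sup>2 / (p \<bullet> (H *v p))"
      using exit by (intro s(4)) auto
    then show ?thesis using False by (simp add: field_simps)
  qed
  then have "s * (s * (p \<bullet> (H *v p))) \<le> s * (norm (res v))\<^sup>2"
    using s(1) by (rule mult_left_mono)
  then have "s * (norm (res v))\<^sup>2 / 2 \<le> q v - q (v + s *\<^sub>R p)"
    using assms(2) by (simp add: q_step power2_eq_square algebra_simps)
  then show thesis using s that by blast
qed

lemma boundary_gradient_step_res:
  "boundary_gradient_step H g \<Delta> v =
    (if res v \<bullet> (H *v res v) \<le> 0 \<or>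
        \<Delta> \<le> norm (v + ((norm (res v))\<^sup>2 / (res v \<bullet> (H *v res v))) *\<^sub>R res v)
     then if res v = 0 then v else to_sphere \<Delta> v (res v)
     else v + ((norm (res v))\<^sup>2 / (res v \<bullet> (H *v res v))) *\<^sub>R res v)"
  unfolding boundary_gradient_step_def res_def Let_def by (rule refl)

text \<open>Either the step reaches the sphere and has length at least
  \<open>\<Delta> - norm v\<close>, or it is the exact line minimizer, with step size at least
  \<open>1 / L\<close>.\<close>

lemma boundary_gradient_step_decrease:
  assumes "norm v < \<Delta>"
  shows "norm (boundary_gradient_step H g \<Delta> v) \<le> \<Delta>"
    "norm (res v) * min (norm (res v) / L) (\<Delta> - norm v) / 2
      \<le> q v - q (boundary_gradient_step H g \<Delta> v)"
proof -
  let ?r = "res v" and ?u = "boundary_gradient_step H g \<Delta> v"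
  let ?\<alpha> = "(norm ?r)\<^sup>2 / (?r \<bullet> (H *v ?r))"
  have "norm ?u \<le> \<Delta> \<and> norm ?r * min (norm ?r / L) (\<Delta> - norm v) / 2 \<le> q v - q ?u"
  proof (cases "?r = 0")
    case True
    then show ?thesis using assms by (simp add: boundary_gradient_step_res)
  next
    case r0: False
    have rr: "?r \<bullet> ?r = (norm ?r)\<^sup>2" by (simp add: power2_norm_eq_inner)
    show ?thesis
    proof (cases "?r \<bullet> (H *v ?r) \<le> 0 \<or> \<Delta> \<le> norm (v + ?\<alpha> *\<^sub>R ?r)")
      case True
      then have u: "?u = to_sphere \<Delta> v ?r"
        using r0 by (simp add: boundary_gradient_step_res)
      obtain s where s: "0 \<le> s" "to_sphere \<Delta> v ?r = v + s *\<^sub>R ?r" "norm (v + s *\<^sub>R ?r) = \<Delta>"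
        "s * (norm ?r)\<^sup>2 / 2 \<le> q v - q (v + s *\<^sub>R ?r)"
        using boundary_step_decrease[OF assms rr r0 True] .
      have "\<Delta> - norm v \<le> s * norm ?r"
        using norm_triangle_ineq[of v "s *\<^sub>R ?r"] s by simp
      then have "norm ?r * min (norm ?r / L) (\<Delta> - norm v) \<le> norm ?r * (s * norm ?r)"
        by (intro mult_left_mono) auto
      then show ?thesis using u s by (simp add: power2_eq_square algebra_simps)
    next
      case False
      then have u: "?u = v + ?\<alpha> *\<^sub>R ?r"
        by (simp add: boundary_gradient_step_res)
      have "norm ?r * min (norm ?r / L) (\<Delta> - norm v) \<le> norm ?r * (norm ?r / L)"
        by (intro mult_left_mono) auto
      also have "\<dots> = (norm ?r)\<^sup>2 * (1 / L)" by (simp add: power2_eq_square)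
      also have "\<dots> \<le> (norm ?r)\<^sup>2 * ?\<alpha>"
        using False L_pos r0 curv_le[of ?r] by (intro mult_left_mono) (auto simp: field_simps)
      finally show ?thesis
        using interior_step_decrease[OF rr] False u by (simp add: algebra_simps)
    qed
  qed
  then show "norm ?u \<le> \<Delta>" "norm ?r * min (norm ?r / L) (\<Delta> - norm v) / 2 \<le> q v - q ?u" by auto
qed

section \<open>Orthogonality and monotonicity of conjugate gradients\<close>

text \<open>
  The witness \<open>K\<close> is the Krylov space spanned by the earlier residuals; its dimension is \<open>t - 1\<close>, which
  bounds the number of iterations. The invariant does not ask for \<open>r \<noteq> 0\<close>, so it also covers the
  state after the exact solution has been reached.
\<close>

definition cg_inv :: "nat \<Rightarrow> real^'n \<Rightarrow> real^'n \<Rightarrow> real^'n \<Rightarrow> bool" where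
  "cg_inv t v r p \<longleftrightarrow> r = res v \<and> 0 \<le> p \<bullet> (v - \<xi>) \<and>
     (\<exists>K. subspace K \<and> Suc (dim K) = t \<and> v - \<xi> \<in> K \<and> p - r \<in> K \<and>
       (\<forall>w\<in>K. w \<bullet> r = 0 \<and> w \<bullet> (H *v p) = 0 \<and> H *v w \<in> span (insert r K)))"

lemma cg_inv_init: "cg_inv 1 \<xi> (res \<xi>) (res \<xi>)"
  unfolding cg_inv_def
  by (auto intro!: exI[of _ "{0}"] simp: subspace_0 span_zero)

lemma cg_inv_inner: "cg_inv t v r p \<Longrightarrow> p \<bullet> r = (norm r)\<^sup>2"
proof -
  assume "cg_inv t v r p"
  then have "(p - r) \<bullet> r = 0" by (auto simp: cg_inv_def)
  then show ?thesis by (simp add: inner_diff_left power2_norm_eq_inner)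
qed

text \<open>\<open>r\<close> is nonzero and orthogonal to \<open>K\<close>, so adding it raises the
  dimension from \<open>t - 1\<close> to \<open>t\<close>.\<close>

lemma cg_inv_le_dim:
  assumes "cg_inv t v r p" "r \<noteq> 0"
  shows "t \<le> CARD('n)"
proof -
  obtain K where K: "subspace K" "Suc (dim K) = t" "\<forall>w\<in>K. w \<bullet> r = 0"
    using assms by (auto simp: cg_inv_def)
  have "r \<notin> span K" using K assms(2) by (metis inner_eq_zero_iff span_eq_iff)
  then have "dim (insert r K) = t" using K by (simp add: dim_insert)
  then show ?thesis by (metis dim_subset_UNIV_cart)
qed

text \<open>The next witness is \<open>span (insert r K)\<close>. The choice of \<alpha> makes
  \<open>r'\<close> orthogonal to \<open>p\<close>, and that of \<beta> makes the new direction
  \<open>H\<close>-conjugate to \<open>p\<close>. The distance to \<xi> cannot shrink because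
  \<open>p\<close> never points back towards \<xi>.\<close>

lemma cg_inv_step:
  assumes inv: "cg_inv t v r p" and r0: "r \<noteq> 0" and pos: "0 < p \<bullet> (H *v p)"
  defines "\<alpha> \<equiv> (norm r)\<^sup>2 / (p \<bullet> (H *v p))"
  defines "r' \<equiv> r - \<alpha> *\<^sub>R (H *v p)"
  defines "\<beta> \<equiv> (norm r')\<^sup>2 / (norm r)\<^sup>2"
  shows "cg_inv (Suc t) (v + \<alpha> *\<^sub>R p) r' (r' + \<beta> *\<^sub>R p)"
    and "norm (v - \<xi>) \<le> norm (v + \<alpha> *\<^sub>R p - \<xi>)"
proof -
  obtain K where K: "subspace K" "Suc (dim K) = t" "v - \<xi> \<in> K" "p - r \<in> K"
    and Kr: "\<And>w. w \<in> K \<Longrightarrow> w \<bullet> r = 0" and Kp: "\<And>w. w \<in> K \<Longrightarrow> w \<bullet> (H *v p) = 0"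
    and KH: "\<And>w. w \<in> K \<Longrightarrow> H *v w \<in> span (insert r K)"
    using inv by (auto simp: cg_inv_def)
  have rv: "r = res v" and pv: "0 \<le> p \<bullet> (v - \<xi>)" using inv by (auto simp: cg_inv_def)
  have \<alpha>: "0 < \<alpha>" "\<alpha> * (p \<bullet> (H *v p)) = (norm r)\<^sup>2" using pos r0 by (auto simp: \<alpha>_def)
  have \<beta>: "0 \<le> \<beta>" "\<beta> * (norm r)\<^sup>2 = (norm r')\<^sup>2" using r0 by (auto simp: \<beta>_def)
  define K' where "K' = span (insert r K)"
  have spK: "span K = K" using K(1) by (simp add: span_eq_iff)
  have sub': "subspace K'" by (simp add: K'_def)
  have KK': "K \<subseteq> K'" unfolding K'_def by (meson insert_subset order_trans span_superset subset_insertI)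
  have rK': "r \<in> K'" unfolding K'_def by (simp add: span_base)
  have pK': "p \<in> K'" using subspace_add[OF sub' subsetD[OF KK' K(4)] rK'] by simp
  \<comment> \<open>As \<open>p - r\<close> lies in \<open>K\<close>, \<open>p\<close> can replace
    \<open>r\<close> as the extra generator of \<open>K'\<close>: orthogonality need only be checked
    against \<open>p\<close> and \<open>K\<close>.\<close>
  have split: "\<exists>c k. k \<in> K \<and> w = c *\<^sub>R p + k" if w: "w \<in> K'" for w
  proof -
    obtain c where c: "w - c *\<^sub>R r \<in> K" using w spK by (auto simp: K'_def span_breakdown_eq)
    have "w - c *\<^sub>R r - c *\<^sub>R (p - r) \<in> K"
      by (rule subspace_diff[OF K(1) c subspace_scale[OF K(1,4)]])
    then have "w - c *\<^sub>R p \<in> K" by (simp add: algebra_simps)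
    then show ?thesis by (metis add.commute diff_add_cancel)
  qed
  have pr: "p \<bullet> r = (norm r)\<^sup>2" using cg_inv_inner[OF inv] .
  have pr': "p \<bullet> r' = 0" using pr \<alpha> by (simp add: r'_def inner_diff_right)
  have K'r': "w \<bullet> r' = 0" if w: "w \<in> K'" for w
  proof -
    obtain c k where "k \<in> K" "w = c *\<^sub>R p + k" using split[OF w] by blast
    then show ?thesis using pr' Kr Kp by (simp add: inner_add_left r'_def inner_diff_right)
  qed
  have Hp: "H *v p = (1 / \<alpha>) *\<^sub>R (r - r')" using \<alpha> by (simp add: r'_def)
  have Hp_in: "H *v p \<in> span (insert r' K')"
    unfolding Hp using rK' by (intro span_scale span_diff) (auto simp: span_base)
  have KH': "H *v w \<in> span (insert r' K')" if w: "w \<in> K'" for w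
  proof -
    obtain c k where ck: "k \<in> K" "w = c *\<^sub>R p + k" using split[OF w] by blast
    have "H *v k \<in> K'" using KH ck K'_def by auto
    then have "H *v k \<in> span (insert r' K')" by (simp add: span_base)
    then show ?thesis
      using Hp_in unfolding ck(2)
      by (simp add: matrix_vector_right_distrib matrix_vector_mult_scaleR span_add span_scale)
  qed
  have Hr': "w \<bullet> (H *v (r' + \<beta> *\<^sub>R p)) = 0" if w: "w \<in> K'" for w
  proof -
    obtain c k where ck: "k \<in> K" "w = c *\<^sub>R p + k" using split[OF w] by blast
    \<comment> \<open>Symmetry moves \<open>H\<close> onto \<open>k\<close>, and
      \<open>H *v k\<close> lies in \<open>K'\<close>, which is orthogonal to
      \<open>r'\<close>.\<close>
    have "k \<bullet> (H *v r') = 0"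
      using KH[OF ck(1)] K'r'[of "H *v k"] by (simp add: K'_def sym[symmetric])
    moreover have "p \<bullet> (H *v r') = - ((norm r')\<^sup>2 / \<alpha>)"
    proof -
      have "r \<bullet> r' = 0" using K'r' rK' by blast
      have "p \<bullet> (H *v r') = (1 / \<alpha>) * ((r - r') \<bullet> r')"
        using sym[of p r'] Hp by simp
      then show ?thesis using \<open>r \<bullet> r' = 0\<close> by (simp add: inner_diff_left power2_norm_eq_inner)
    qed
    moreover have "\<beta> * (p \<bullet> (H *v p)) = (norm r')\<^sup>2 / \<alpha>"
    proof -
      have "p \<bullet> (H *v p) = (norm r)\<^sup>2 / \<alpha>" using \<alpha> by (simp add: field_simps)
      then show ?thesis using \<beta>(2) by simp
    qed
    moreover have "w \<bullet> (H *v (r' + \<beta> *\<^sub>R p)) =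
        c * (p \<bullet> (H *v r') + \<beta> * (p \<bullet> (H *v p))) + (k \<bullet> (H *v r') + \<beta> * (k \<bullet> (H *v p)))"
      by (simp add: ck(2) matrix_vector_right_distrib matrix_vector_mult_scaleR inner_add_left
          inner_add_right algebra_simps)
    ultimately show ?thesis using Kp[OF ck(1)] by simp
  qed
  have "r \<notin> span K" using Kr r0 spK by (metis inner_eq_zero_iff)
  then have dim': "dim K' = t" using K(2) by (simp add: K'_def dim_insert)
  have w': "v + \<alpha> *\<^sub>R p - \<xi> = (v - \<xi>) + \<alpha> *\<^sub>R p" by simp
  have wK': "v + \<alpha> *\<^sub>R p - \<xi> \<in> K'"
    unfolding w' using KK' K pK' sub' by (intro subspace_add subspace_scale) auto
  have "(r' + \<beta> *\<^sub>R p) \<bullet> (v + \<alpha> *\<^sub>R p - \<xi>) = \<beta> * (p \<bullet> (v - \<xi>) + \<alpha> * (norm p)\<^sup>2)"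
  proof -
    have "r' \<bullet> (v + \<alpha> *\<^sub>R p - \<xi>) = 0" using K'r'[OF wK'] by (simp add: inner_commute)
    then show ?thesis
      by (simp add: inner_add_left w' inner_add_right[of p] power2_norm_eq_inner del: inner_diff_right)
  qed
  also have "\<dots> \<ge> 0" using \<beta> \<alpha> pv by simp
  finally have pos': "0 \<le> (r' + \<beta> *\<^sub>R p) \<bullet> (v + \<alpha> *\<^sub>R p - \<xi>)" .
  have "r' = res (v + \<alpha> *\<^sub>R p)" by (simp add: r'_def res_step rv)
  then show "cg_inv (Suc t) (v + \<alpha> *\<^sub>R p) r' (r' + \<beta> *\<^sub>R p)"
    unfolding cg_inv_def
    using pos' sub' dim' wK' pK' K'r' Hr' KH'
    by (auto intro!: exI[of _ K'] subspace_scale)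
  have "(norm (v + \<alpha> *\<^sub>R p - \<xi>))\<^sup>2 = (norm (v - \<xi>))\<^sup>2 + 2 * \<alpha> * (p \<bullet> (v - \<xi>)) + \<alpha>\<^sup>2 * (norm p)\<^sup>2"
    unfolding w' power2_norm_eq_inner
    by (simp add: inner_add_left inner_add_right inner_commute power2_eq_square algebra_simps)
  then show "norm (v - \<xi>) \<le> norm (v + \<alpha> *\<^sub>R p - \<xi>)"
    using \<alpha> pv by - (rule power2_le_imp_le, auto)
qed

text \<open>
  Continuing the iteration in exact arithmetic ends at the Newton step \<open>vs\<close>, and the distance to \<open>\<xi>\<close>
  never decreases on the way.
\<close>

lemma cg_inv_norm_le:
  assumes pd: "\<And>w. w \<noteq> 0 \<Longrightarrow> 0 < w \<bullet> (H *v w)" and newton: "res vs = 0"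
    and "cg_inv t v r p"
  shows "norm (v - \<xi>) \<le> norm (vs - \<xi>)"
  using assms(3)
\<comment> \<open>While the residual is nonzero, \<open>t\<close> is at most the dimension, so
  finitely many steps remain. Once it vanishes, positive definiteness forces
  \<open>v = vs\<close>.\<close>
proof (induction "Suc CARD('n) - t" arbitrary: t v r p rule: less_induct)
  case less
  show ?case
  proof (cases "r = 0")
    case True
    then have "res v = 0" using less.prems by (simp add: cg_inv_def)
    then have "H *v (v - vs) = 0"
      using newton by (simp add: res_def matrix_vector_mult_diff_distrib neg_eq_iff_add_eq_0 add_eq_0_iff2)
    then have "v = vs" using pd[of "v - vs"] by force
    then show ?thesis by simp
  next
    case False
    then have "p \<noteq> 0" using cg_inv_inner[OF less.prems] by auto
    note step = cg_inv_step[OF less.prems False pd[OF this]]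
    have "t \<le> CARD('n)" using cg_inv_le_dim[OF less.prems False] .
    then show ?thesis using less.hyps[OF _ step(1)] step(2) by force
  qed
qed

section \<open>Model decrease during the iterations\<close>

text \<open>The Cauchy decrease of the first iteration; \<open>\<Delta> / 4\<close> bounds from
  below the distance from \<xi> to the inner sphere of radius \<open>\<Delta> / 2\<close>.\<close>

definition first_decrease :: real where
  "first_decrease = norm (res \<xi>) * min (norm (res \<xi>) / L) (\<Delta> / 4) / 2"

text \<open>The disjunction separates the first iteration, a gradient step from \<xi>, from later
  ones, where the first decrease has already been secured.\<close>

definition good :: "nat \<Rightarrow> real^'n \<Rightarrow> real^'n \<Rightarrow> real^'n \<Rightarrow> bool" where
  "good t v r p \<longleftrightarrow> cg_inv t v r p \<and> r \<noteq> 0 \<and> norm v < \<Delta> / 2 \<and>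
     (v = \<xi> \<and> p = r \<or> first_decrease \<le> q \<xi> - q v)"

lemma good_inner:
  assumes "good t v r p"
  shows "r = res v" "p \<bullet> r = (norm r)\<^sup>2"
proof -
  have inv: "cg_inv t v r p" using assms by (simp add: good_def)
  then show "r = res v" by (simp add: cg_inv_def)
  show "p \<bullet> r = (norm r)\<^sup>2" using cg_inv_inner[OF inv] .
qed

text \<open>The first step has size at least \<open>1 / L\<close>; a later one does not raise the
  model.\<close>

lemma good_interior_decrease:
  assumes "good t v r p" "0 < p \<bullet> (H *v p)"
  shows "first_decrease \<le> q \<xi> - q (v + ((norm r)\<^sup>2 / (p \<bullet> (H *v p))) *\<^sub>R p)"
proof -
  let ?\<alpha> = "(norm r)\<^sup>2 / (p \<bullet> (H *v p))"
  note g = good_inner[OF assms(1)]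
  have eq: "q v - q (v + ?\<alpha> *\<^sub>R p) = ?\<alpha> * (norm r)\<^sup>2 / 2"
    using interior_step_decrease[of p v] assms(2) g by simp
  show ?thesis
  proof (cases "v = \<xi> \<and> p = r")
    case True
    have "norm r * min (norm r / L) (\<Delta> / 4) \<le> norm r * (norm r / L)"
      by (intro mult_left_mono) auto
    also have "\<dots> = (1 / L) * (norm r)\<^sup>2" by (simp add: power2_eq_square)
    also have "\<dots> \<le> ?\<alpha> * (norm r)\<^sup>2"
      using True assms(2) L_pos curv_le[of r]
      by (intro mult_right_mono) (auto simp: field_simps)
    finally show ?thesis using eq True g(1) by (simp add: first_decrease_def)
  next
    case False
    have "0 \<le> ?\<alpha> * (norm r)\<^sup>2 / 2" using assms(2) by simp
    then show ?thesis using False assms(1) eq unfolding good_def by linarith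
  qed
qed

text \<open>A truncated first step has length at least \<open>\<Delta> / 4\<close>; a later one does
  not raise the model.\<close>

lemma good_boundary_decrease:
  assumes "good t v r p"
    "p \<bullet> (H *v p) \<le> 0 \<or> \<Delta> / 2 \<le> norm (v + ((norm r)\<^sup>2 / (p \<bullet> (H *v p))) *\<^sub>R p)"
  shows "norm (to_sphere (\<Delta> / 2) v p) = \<Delta> / 2"
    and "first_decrease \<le> q \<xi> - q (to_sphere (\<Delta> / 2) v p)"
proof -
  note g = good_inner[OF assms(1)]
  have *: "norm v < \<Delta> / 2" "p \<bullet> res v = (norm (res v))\<^sup>2" "res v \<noteq> 0"
    using g assms(1) by (auto simp: good_def)
  obtain s where s: "0 \<le> s" "to_sphere (\<Delta> / 2) v p = v + s *\<^sub>R p" "norm (v + s *\<^sub>R p) = \<Delta> / 2"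
    "s * (norm r)\<^sup>2 / 2 \<le> q v - q (v + s *\<^sub>R p)"
    using boundary_step_decrease[OF *] assms(2) unfolding g(1) by blast
  show "norm (to_sphere (\<Delta> / 2) v p) = \<Delta> / 2" using s by simp
  show "first_decrease \<le> q \<xi> - q (to_sphere (\<Delta> / 2) v p)"
  proof (cases "v = \<xi> \<and> p = r")
    case True
    have "\<Delta> / 4 \<le> s * norm r"
      using norm_triangle_ineq[of v "s *\<^sub>R r"] True s start by simp
    then have "norm r * min (norm r / L) (\<Delta> / 4) \<le> norm r * (s * norm r)"
      by (intro mult_left_mono) auto
    then show ?thesis using True s g by (simp add: first_decrease_def power2_eq_square algebra_simps)
  next
    case False
    have "0 \<le> s * (norm r)\<^sup>2 / 2" using s by simp
    then show ?thesis using False assms(1) s unfolding good_def s(2) by linarith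
  qed
qed

section \<open>Exits and termination of the solver\<close>

text \<open>Records the state before the last iteration, so that \<open>cg_inv_step\<close> can
  still be applied to it. The immediate halt in \<open>tcg_init\<close> is left to the hypothesis
  \<open>res \<xi> \<noteq> 0\<close> of \<open>tcg_bg_terminates\<close>.\<close>

definition interior_exit :: "real \<Rightarrow> real \<Rightarrow> real^'n \<Rightarrow> bool" where
  "interior_exit \<omega>\<^sub>1 \<omega>\<^sub>2 u \<longleftrightarrow> (\<exists>t v r p. good t v r p \<and> 0 < p \<bullet> (H *v p) \<and>
     u = v + ((norm r)\<^sup>2 / (p \<bullet> (H *v p))) *\<^sub>R p \<and> norm u < \<Delta> / 2 \<and>
     norm (res u) \<le> min (\<omega>\<^sub>1 * norm g) (\<omega>\<^sub>2 * (norm g)\<^sup>2))"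

definition boundary_exit :: "real^'n \<Rightarrow> bool" where
  "boundary_exit u \<longleftrightarrow> (\<exists>t v r p. good t v r p \<and>
     (p \<bullet> (H *v p) \<le> 0 \<or> \<Delta> / 2 \<le> norm (v + ((norm r)\<^sup>2 / (p \<bullet> (H *v p))) *\<^sub>R p)) \<and>
     u = boundary_gradient_step H g \<Delta> (to_sphere (\<Delta> / 2) v p))"

fun state_inv :: "real \<Rightarrow> real \<Rightarrow> (real^'n) tcg_state \<Rightarrow> bool" where
  "state_inv \<omega>\<^sub>1 \<omega>\<^sub>2 (Running t v r p) = good t v r p"
| "state_inv \<omega>\<^sub>1 \<omega>\<^sub>2 (Halted u Residual T) = interior_exit \<omega>\<^sub>1 \<omega>\<^sub>2 u"
| "state_inv \<omega>\<^sub>1 \<omega>\<^sub>2 (Halted u Boundary T) = boundary_exit u"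

fun remaining :: "(real^'n) tcg_state \<Rightarrow> nat" where
  "remaining (Running t v r p) = Suc CARD('n) - t"
| "remaining (Halted u s T) = 0"

text \<open>The measure is positive while running, since \<open>cg_inv_le_dim\<close> bounds
  \<open>t\<close> by the dimension.\<close>

lemma state_inv_step:
  assumes "0 < \<omega>\<^sub>1" "0 < \<omega>\<^sub>2" "state_inv \<omega>\<^sub>1 \<omega>\<^sub>2 s" "running s"
  shows "state_inv \<omega>\<^sub>1 \<omega>\<^sub>2 (tcg_step \<omega>\<^sub>1 \<omega>\<^sub>2 H g \<Delta> s) \<and>
    remaining (tcg_step \<omega>\<^sub>1 \<omega>\<^sub>2 H g \<Delta> s) < remaining s"
proof -
  obtain t v r p where s: "s = Running t v r p" using assms(4) by (cases s) auto
  have good: "good t v r p" using assms(3) s by simp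
  note g = good_inner[OF good]
  have r0: "r \<noteq> 0" and inv: "cg_inv t v r p" using good by (auto simp: good_def)
  have t: "t \<le> CARD('n)" using cg_inv_le_dim inv r0 .
  define \<alpha> where "\<alpha> = (norm r)\<^sup>2 / (p \<bullet> (H *v p))"
  define r' where "r' = r - \<alpha> *\<^sub>R (H *v p)"
  have r': "r' = res (v + \<alpha> *\<^sub>R p)" by (simp add: r'_def res_step g)
  show ?thesis
  proof (cases "p \<bullet> (H *v p) \<le> 0 \<or> \<Delta> / 2 \<le> norm (v + \<alpha> *\<^sub>R p)")
    case True
    then have "tcg_step \<omega>\<^sub>1 \<omega>\<^sub>2 H g \<Delta> s =
        Halted (boundary_gradient_step H g \<Delta> (to_sphere (\<Delta> / 2) v p)) Boundary t"
      by (simp add: s \<alpha>_def Let_def)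
    moreover have "boundary_exit (boundary_gradient_step H g \<Delta> (to_sphere (\<Delta> / 2) v p))"
      unfolding boundary_exit_def using good True[unfolded \<alpha>_def] by blast
    ultimately show ?thesis using t by (simp add: s)
  next
    case False
    then have pos: "0 < p \<bullet> (H *v p)" and lt: "norm (v + \<alpha> *\<^sub>R p) < \<Delta> / 2" by auto
    show ?thesis
    proof (cases "norm r' \<le> min (\<omega>\<^sub>1 * norm g) (\<omega>\<^sub>2 * (norm g)\<^sup>2)")
      case True
      then have "tcg_step \<omega>\<^sub>1 \<omega>\<^sub>2 H g \<Delta> s = Halted (v + \<alpha> *\<^sub>R p) Residual t"
        using pos lt by (simp add: s \<alpha>_def[symmetric] r'_def Let_def)
      moreover have "interior_exit \<omega>\<^sub>1 \<omega>\<^sub>2 (v + \<alpha> *\<^sub>R p)"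
        unfolding interior_exit_def
        using good pos lt[unfolded \<alpha>_def] True[unfolded r'] unfolding \<alpha>_def by blast
      ultimately show ?thesis using t by (simp add: s)
    next
      case far: False
      then have step: "tcg_step \<omega>\<^sub>1 \<omega>\<^sub>2 H g \<Delta> s =
          Running (Suc t) (v + \<alpha> *\<^sub>R p) r' (r' + ((norm r')\<^sup>2 / (norm r)\<^sup>2) *\<^sub>R p)"
        using pos lt by (simp add: s \<alpha>_def[symmetric] r'_def[symmetric] Let_def)
      \<comment> \<open>The thresholds of the failed residual test are nonnegative.\<close>
      have "r' \<noteq> 0" using far assms by auto
      then have "good (Suc t) (v + \<alpha> *\<^sub>R p) r' (r' + ((norm r')\<^sup>2 / (norm r)\<^sup>2) *\<^sub>R p)"
        using cg_inv_step(1)[OF inv r0 pos, folded \<alpha>_def, folded r'_def] lt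
          good_interior_decrease[OF good pos, folded \<alpha>_def]
        by (simp only: good_def simp_thms)
      then show ?thesis unfolding step using t by (simp add: s)
    qed
  qed
qed

lemma tcg_bg_terminates:
  assumes "0 < \<omega>\<^sub>1" "0 < \<omega>\<^sub>2" "res \<xi> \<noteq> 0"
  obtains u st T where "tcg_bg \<omega>\<^sub>1 \<omega>\<^sub>2 H g \<Delta> \<xi> = Some (u, st, T)"
    "st = Residual \<Longrightarrow> interior_exit \<omega>\<^sub>1 \<omega>\<^sub>2 u" "st = Boundary \<Longrightarrow> boundary_exit u"
proof -
  let ?s = "tcg_init H g \<xi>" and ?c = "tcg_step \<omega>\<^sub>1 \<omega>\<^sub>2 H g \<Delta>"
  have "?s = Running 1 \<xi> (res \<xi>) (res \<xi>)"
    using assms(3) by (simp add: tcg_init_def res_def Let_def)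
  then have init: "state_inv \<omega>\<^sub>1 \<omega>\<^sub>2 ?s"
    using assms(3) cg_inv_init start \<Delta>_pos by (simp add: good_def)
  obtain s where s: "while_option running ?c ?s = Some s"
    using measure_while_option_Some[where P = "state_inv \<omega>\<^sub>1 \<omega>\<^sub>2" and f = remaining,
        OF state_inv_step[OF assms(1,2)] init] by auto
  have "state_inv \<omega>\<^sub>1 \<omega>\<^sub>2 (?c s')" if "state_inv \<omega>\<^sub>1 \<omega>\<^sub>2 s'" "running s'" for s'
    using state_inv_step[OF assms(1,2) that] by (rule conjunct1)
  then have inv: "state_inv \<omega>\<^sub>1 \<omega>\<^sub>2 s"
    by (rule while_option_rule[where P = "state_inv \<omega>\<^sub>1 \<omega>\<^sub>2", OF _ s init])
  have "\<not> running s" using while_option_stop[OF s] .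
  then obtain u st T where st: "s = Halted u st T" by (cases s) auto
  show thesis
  proof
    show "tcg_bg \<omega>\<^sub>1 \<omega>\<^sub>2 H g \<Delta> \<xi> = Some (u, st, T)" by (simp add: tcg_bg_def s st)
  qed (use inv st in auto)
qed

lemma interior_exitD:
  assumes "interior_exit \<omega>\<^sub>1 \<omega>\<^sub>2 u"
  shows "norm u < \<Delta> / 2" "first_decrease \<le> q \<xi> - q u"
    "norm (res u) \<le> \<omega>\<^sub>1 * norm g" "norm (res u) \<le> \<omega>\<^sub>2 * (norm g)\<^sup>2"
  using assms good_interior_decrease by (auto simp: interior_exit_def)

text \<open>The witness is the point on the inner sphere where the boundary gradient step starts.
  The decreases before and after it add up, and \<open>\<Delta> / 2\<close> is the distance left to
  the outer sphere.\<close>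

lemma boundary_exitE:
  assumes "boundary_exit u"
  obtains v where "norm u \<le> \<Delta>" "norm v = \<Delta> / 2"
    "first_decrease + norm (res v) * min (norm (res v) / L) (\<Delta> / 2) / 2 \<le> q \<xi> - q u"
proof -
  obtain t v r p where good: "good t v r p"
    and ex: "p \<bullet> (H *v p) \<le> 0 \<or> \<Delta> / 2 \<le> norm (v + ((norm r)\<^sup>2 / (p \<bullet> (H *v p))) *\<^sub>R p)"
    and u: "u = boundary_gradient_step H g \<Delta> (to_sphere (\<Delta> / 2) v p)"
    using assms by (auto simp: boundary_exit_def)
  note d = good_boundary_decrease[OF good ex]
  have "norm (to_sphere (\<Delta> / 2) v p) < \<Delta>" using d \<Delta>_pos by simp
  from boundary_gradient_step_decrease[OF this] d show thesis
    by (intro that[of "to_sphere (\<Delta> / 2) v p"]) (auto simp: u)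
qed

lemma exit_bounds:
  assumes "interior_exit \<omega>\<^sub>1 \<omega>\<^sub>2 u \<or> boundary_exit u"
  shows "norm u \<le> \<Delta>" "first_decrease \<le> q \<xi> - q u"
proof -
  have "norm u \<le> \<Delta> \<and> first_decrease \<le> q \<xi> - q u"
    using assms
  proof
    assume "interior_exit \<omega>\<^sub>1 \<omega>\<^sub>2 u"
    then show ?thesis using interior_exitD(1,2)[of \<omega>\<^sub>1 \<omega>\<^sub>2 u] \<Delta>_pos by linarith
  next
    assume "boundary_exit u"
    then obtain v where v: "norm u \<le> \<Delta>"
      "first_decrease + norm (res v) * min (norm (res v) / L) (\<Delta> / 2) / 2 \<le> q \<xi> - q u"
      by (rule boundary_exitE)
    have "0 \<le> norm (res v) * min (norm (res v) / L) (\<Delta> / 2) / 2"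
      using L_pos \<Delta>_pos by simp
    then show ?thesis using v by linarith
  qed
  then show "norm u \<le> \<Delta>" "first_decrease \<le> q \<xi> - q u" by auto
qed

lemma interior_exit_norm_le:
  assumes pd: "\<And>w. w \<noteq> 0 \<Longrightarrow> 0 < w \<bullet> (H *v w)" and newton: "res vs = 0"
    and "interior_exit \<omega>\<^sub>1 \<omega>\<^sub>2 u"
  shows "norm (u - \<xi>) \<le> norm (vs - \<xi>)"
proof -
  obtain t v r p where "good t v r p" "0 < p \<bullet> (H *v p)"
    and u: "u = v + ((norm r)\<^sup>2 / (p \<bullet> (H *v p))) *\<^sub>R p"
    using assms(3) by (auto simp: interior_exit_def)
  then show ?thesis
    unfolding u by (intro cg_inv_norm_le[OF pd newton cg_inv_step(1)]) (auto simp: good_def)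
qed

text \<open>Positive definiteness excludes a stop by curvature. The full conjugate gradient step
  again satisfies \<open>cg_inv\<close>, so it is no farther from \<xi> than the Newton step and
  misses the inner sphere.\<close>

lemma not_boundary_exit:
  assumes pd: "\<And>w. w \<noteq> 0 \<Longrightarrow> 0 < w \<bullet> (H *v w)" and newton: "res vs = 0"
    and small: "norm (vs - \<xi>) + norm \<xi> < \<Delta> / 2"
  shows "\<not> boundary_exit u"
proof
  assume "boundary_exit u"
  then obtain t v r p where good: "good t v r p"
    and ex: "p \<bullet> (H *v p) \<le> 0 \<or> \<Delta> / 2 \<le> norm (v + ((norm r)\<^sup>2 / (p \<bullet> (H *v p))) *\<^sub>R p)"
    by (auto simp: boundary_exit_def)
  have "p \<noteq> 0" using good_inner(2)[OF good] good by (auto simp: good_def)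
  from pd[OF this] have pos: "0 < p \<bullet> (H *v p)" .
  let ?v = "v + ((norm r)\<^sup>2 / (p \<bullet> (H *v p))) *\<^sub>R p"
  have "norm (?v - \<xi>) \<le> norm (vs - \<xi>)"
    using good pos by (intro cg_inv_norm_le[OF pd newton cg_inv_step(1)]) (auto simp: good_def)
  moreover have "norm ?v \<le> norm (?v - \<xi>) + norm \<xi>"
    using norm_triangle_ineq[of "?v - \<xi>" \<xi>] by simp
  ultimately show False using ex pos small by linarith
qed

section \<open>Lower bounds on the model decrease\<close>

text \<open>The only use of the sign rule for the noise.\<close>

lemma norm_res_start: "(norm g)\<^sup>2 + (norm (H *v \<xi>))\<^sup>2 \<le> (norm (res \<xi>))\<^sup>2"
proof -
  have "(norm (res \<xi>))\<^sup>2 = (norm (H *v \<xi>))\<^sup>2 + 2 * ((H *v \<xi>) \<bullet> g) + (norm g)\<^sup>2"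
    unfolding res_def norm_minus_cancel power2_norm_eq_inner
    by (simp add: inner_add_left inner_add_right inner_commute)
  then show ?thesis using angle by simp
qed

lemma norm_g_le: "norm g \<le> norm (res \<xi>)"
  using order_trans[OF _ norm_res_start, of "(norm g)\<^sup>2"] by - (rule power2_le_imp_le, auto)

lemma first_decrease_ge:
  assumes "0 \<le> a" "a \<le> norm g" "a / L \<le> \<Delta> / 4"
  shows "a\<^sup>2 / (2 * L) \<le> first_decrease"
  unfolding first_decrease_def
  using assms norm_g_le L_pos by (intro half_mult_min_ge) auto

lemma first_decrease_pos: "res \<xi> \<noteq> 0 \<Longrightarrow> 0 < first_decrease"
  using L_pos \<Delta>_pos by (simp add: first_decrease_def)

text \<open>The residual at \<xi> is at least as large as \<open>g\<close>, so the radius is the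
  active term of the minimum in \<open>first_decrease\<close>.\<close>

lemma large_gradient_decrease:
  assumes "\<gamma> \<le> norm g" "0 \<le> \<gamma>" "\<Delta> * L \<le> \<gamma>"
  shows "\<gamma> * \<Delta> / 8 \<le> first_decrease"
proof -
  have "\<Delta> * L \<le> norm (res \<xi>)" using assms norm_g_le by linarith
  then have "\<Delta> \<le> norm (res \<xi>) / L" using L_pos by (simp add: field_simps)
  then have "\<Delta> / 4 \<le> norm (res \<xi>) / L" using \<Delta>_pos by linarith
  then have "min (norm (res \<xi>) / L) (\<Delta> / 4) = \<Delta> / 4" by (rule min_absorb2)
  then have "first_decrease = norm (res \<xi>) * \<Delta> / 8" by (simp add: first_decrease_def)
  moreover have "\<gamma> * \<Delta> \<le> norm (res \<xi>) * \<Delta>"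
    using assms norm_g_le \<Delta>_pos by (intro mult_right_mono) auto
  ultimately show ?thesis by simp
qed

text \<open>
  At any \<open>v\<close>, the vectors \<open>g\<close> and \<open>res v\<close> cannot both be small compared to \<open>H v\<close>: either the first
  step or the final boundary gradient step gains enough. The constant \<open>9/512\<close> only just exceeds the
  \<open>1/60\<close> that the constant \<open>10\<close> in \<open>Delta_crit\<close> asks for.
\<close>

lemma nonsingular_decrease:
  assumes ns: "\<And>w. 3 / 4 * \<mu> * norm w \<le> norm (H *v w)" and \<mu>: "0 < \<mu>" "\<mu> \<le> L"
    and "\<omega>\<^sub>1 < 1" and ex: "interior_exit \<omega>\<^sub>1 \<omega>\<^sub>2 u \<or> boundary_exit u"
  shows "9 / 512 * \<mu>\<^sup>2 / L * (norm u)\<^sup>2 \<le> q \<xi> - q u"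
proof -
  \<comment> \<open>Discards the factor \<open>\<mu> / L \<le> 1\<close>; used for the side
    conditions \<open>a / L \<le> b\<close>.\<close>
  have \<mu>L: "c * \<mu> * s / L \<le> b" if "c * s \<le> b" "0 \<le> c * s" for c s b
  proof -
    have "(c * s) * (\<mu> / L) \<le> (c * s) * 1" using that \<mu> L_pos by (intro mult_left_mono) auto
    also have "\<dots> \<le> b" using that by simp
    finally show ?thesis by (simp add: algebra_simps)
  qed
  have Hle: "norm (H *v w) \<le> norm g + norm (res w)" for w
  proof -
    have "H *v w = - g - res w" by (simp add: res_def)
    then show ?thesis by (metis norm_minus_cancel norm_triangle_ineq4)
  qed
  from ex show ?thesis
  proof
    assume "interior_exit \<omega>\<^sub>1 \<omega>\<^sub>2 u"
    note u = interior_exitD[OF this]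
    have "\<omega>\<^sub>1 * norm g \<le> norm g" using mult_right_mono[of \<omega>\<^sub>1 1 "norm g"] \<open>\<omega>\<^sub>1 < 1\<close> by simp
    \<comment> \<open>The residual is at most \<open>norm g\<close>, so the sum in
      \<open>Hle\<close> is at most \<open>2 * norm g\<close>, which halves the 3/4.\<close>
    then have "3 / 8 * \<mu> * norm u \<le> norm g" using ns[of u] Hle[of u] u(3) by linarith
    then have "(3 / 8 * \<mu> * norm u)\<^sup>2 / (2 * L) \<le> first_decrease"
      using u(1) \<mu> norm_ge_zero[of u] by (intro first_decrease_ge \<mu>L) (auto simp del: norm_ge_zero)
    also have "\<dots> \<le> q \<xi> - q u" by (rule u)
    finally have "9 / 128 * (\<mu>\<^sup>2 / L * (norm u)\<^sup>2) \<le> q \<xi> - q u"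
      by (simp add: power_mult_distrib power_divide)
    moreover have "0 \<le> \<mu>\<^sup>2 / L * (norm u)\<^sup>2" using L_pos by simp
    ultimately show ?thesis by simp
  next
    assume "boundary_exit u"
    then obtain v where u: "norm u \<le> \<Delta>" and v: "norm v = \<Delta> / 2"
      and dec: "first_decrease + norm (res v) * min (norm (res v) / L) (\<Delta> / 2) / 2 \<le> q \<xi> - q u"
      by (rule boundary_exitE)
    have nonneg: "0 \<le> first_decrease" "0 \<le> norm (res v) * min (norm (res v) / L) (\<Delta> / 2) / 2"
      using L_pos \<Delta>_pos by (auto simp: first_decrease_def)
    \<comment> \<open>\<open>norm v = \<Delta> / 2\<close> turns 3/4 into 3/8; one of the two
      summands carries at least half of it, and
      \<open>(3 / 16)\<^sup>2 / 2 = 9 / 512\<close>.\<close>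
    have "3 / 8 * \<mu> * \<Delta> \<le> norm g + norm (res v)" using ns[of v] Hle[of v] v by simp
    then consider "3 / 16 * \<mu> * \<Delta> \<le> norm g" | "3 / 16 * \<mu> * \<Delta> \<le> norm (res v)" by linarith
    then have "(3 / 16 * \<mu> * \<Delta>)\<^sup>2 / (2 * L) \<le> q \<xi> - q u"
    proof cases
      case 1
      have "(3 / 16 * \<mu> * \<Delta>)\<^sup>2 / (2 * L) \<le> first_decrease"
        using 1 \<Delta>_pos \<mu> by (intro first_decrease_ge \<mu>L) auto
      then show ?thesis using dec nonneg by linarith
    next
      case 2
      have "(3 / 16 * \<mu> * \<Delta>)\<^sup>2 / (2 * L) \<le> norm (res v) * min (norm (res v) / L) (\<Delta> / 2) / 2"
        using 2 \<Delta>_pos \<mu> L_pos by (intro half_mult_min_ge \<mu>L) auto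
      then show ?thesis using dec nonneg by linarith
    qed
    then have "9 / 512 * \<mu>\<^sup>2 / L * \<Delta>\<^sup>2 \<le> q \<xi> - q u"
      by (simp add: power_mult_distrib power_divide)
    moreover have "9 / 512 * \<mu>\<^sup>2 / L * (norm u)\<^sup>2 \<le> 9 / 512 * \<mu>\<^sup>2 / L * \<Delta>\<^sup>2"
      using u L_pos by (intro mult_left_mono power_mono) auto
    ultimately show ?thesis by linarith
  qed
qed

end

section \<open>Acceptance of steps\<close>

lemma Min4_le:
  "Min {a, b, c, d} \<le> a" "Min {a, b, c, d} \<le> b" "Min {a, b, c, d} \<le> c" "Min {a, b, c, d} \<le> (d::real)"
  by auto

context cost
begin

section \<open>The Hessian near a critical point\<close>

lemma morse_le_lipschitz:
  assumes "morse \<mu> f" "critical_point f xb"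
  shows "\<mu> \<le> L\<^sub>G"
proof -
  obtain w :: "real^'n" where "norm w = 1" using vector_choose_size[of 1] by auto
  moreover have "\<mu> * norm w \<le> norm (hess f xb *v w)" using assms by (simp add: morse_def)
  ultimately show ?thesis using hess_norm_le[of xb w] by simp
qed

lemma hess_near:
  assumes "norm (x - xb) \<le> r"
  shows "norm (hess f x *v w - hess f xb *v w) \<le> L\<^sub>H * r * norm w"
proof -
  have "L\<^sub>H * norm (x - xb) * norm w \<le> L\<^sub>H * r * norm w"
    using assms L_pos by (intro mult_right_mono mult_left_mono) auto
  then show ?thesis using hess_lipschitz[of x w xb] by (rule order_trans[rotated])
qed

text \<open>Within this radius the Hessian changes by at most
  \<open>\<mu>\<^sup>2 / (4 * L\<^sub>G)\<close>, which is at most \<open>\<mu> / 4\<close> because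
  \<open>\<mu> \<le> L\<^sub>G\<close>.\<close>

lemma hess_nonsingular_near_critical:
  assumes "morse \<mu> f" "0 < \<mu>" "critical_point f xb" "norm (x - xb) \<le> \<mu>\<^sup>2 / (4 * L\<^sub>H * L\<^sub>G)"
  shows "3 / 4 * \<mu> * norm w \<le> norm (hess f x *v w)"
proof -
  have "norm (hess f x *v w - hess f xb *v w) \<le> L\<^sub>H * (\<mu>\<^sup>2 / (4 * L\<^sub>H * L\<^sub>G)) * norm w"
    by (rule hess_near[OF assms(4)])
  also have "\<dots> \<le> \<mu> / 4 * norm w"
  proof (rule mult_right_mono)
    have "\<mu> * \<mu> \<le> \<mu> * L\<^sub>G" using morse_le_lipschitz assms by (intro mult_left_mono) auto
    then show "L\<^sub>H * (\<mu>\<^sup>2 / (4 * L\<^sub>H * L\<^sub>G)) \<le> \<mu> / 4"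
      using L_pos by (simp add: field_simps power2_eq_square)
  qed simp
  finally have "norm (hess f x *v w - hess f xb *v w) \<le> \<mu> / 4 * norm w" .
  moreover have "\<mu> * norm w \<le> norm (hess f xb *v w)" using assms by (simp add: morse_def)
  moreover have "norm (hess f xb *v w) - norm (hess f x *v w) \<le> norm (hess f x *v w - hess f xb *v w)"
    by (metis norm_minus_commute norm_triangle_ineq2)
  ultimately show ?thesis by linarith
qed

section \<open>Model decrease against Taylor error\<close>

text \<open>The term \<theta> makes the denominator the decrease measured from \<xi>, the quantity
  the solver controls; the numerator differs from it by the model error at \<open>u\<close>.\<close>

lemma tr_ratio_ge:
  assumes "f (x + u) - f x - tr_model f x u \<le> (1 - \<rho>\<^sub>1) * (tr_model f x \<xi> - tr_model f x u)"
    and "tr_model f x u < tr_model f x \<xi>"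
  shows "\<rho>\<^sub>1 \<le> tr_ratio f x \<xi> u"
proof -
  let ?N = "f x - f (x + u) + tr_model f x \<xi>" and ?D = "tr_model f x \<xi> - tr_model f x u"
  have "tr_model f x 0 = 0" by (simp add: tr_model_def)
  then have "tr_ratio f x \<xi> u = ?N / ?D" by (simp add: tr_ratio_def Let_def)
  moreover have "\<rho>\<^sub>1 * ?D \<le> ?N" using assms(1) by (simp add: left_diff_distrib)
  ultimately show ?thesis using assms(2) by (simp add: pos_le_divide_eq)
qed

lemma tr_model_error_quadratic: "f (x + u) - f x - tr_model f x u \<le> L\<^sub>G * (norm u)\<^sup>2"
proof -
  have "- (u \<bullet> (hess f x *v u)) \<le> norm u * norm (hess f x *v u)"
    using Cauchy_Schwarz_ineq2[of u "hess f x *v u"] by linarith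
  also have "\<dots> \<le> norm u * (L\<^sub>G * norm u)" by (intro mult_left_mono hess_norm_le) auto
  also have "\<dots> = L\<^sub>G * (norm u)\<^sup>2" by (simp add: power2_eq_square)
  finally show ?thesis using f_upper[of x u] unfolding tr_model_def by linarith
qed

lemma subproblem_at:
  assumes "0 < \<Delta>" "norm \<xi> \<le> \<Delta> / 4" "0 \<le> (hess f x *v \<xi>) \<bullet> grad f x"
  shows "subproblem (hess f x) (grad f x) \<xi> \<Delta> L\<^sub>G"
  using assms hess_symmetric hess_norm_le L_pos by unfold_locales auto

text \<open>The decrease is at least linear in the radius and the error at most quadratic; the bound
  on the radius is where they balance.\<close>

lemma tr_ratio_ge_large_gradient:
  assumes "subproblem (hess f x) (grad f x) \<xi> \<Delta> L\<^sub>G"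
    and ex: "subproblem.interior_exit (hess f x) (grad f x) \<xi> \<Delta> L\<^sub>G \<omega>\<^sub>1 \<omega>\<^sub>2 u \<or>
      subproblem.boundary_exit (hess f x) (grad f x) \<xi> \<Delta> L\<^sub>G u"
    and \<rho>\<^sub>1: "0 < \<rho>\<^sub>1" "\<rho>\<^sub>1 < 1"
    and \<gamma>: "0 < \<gamma>" "\<gamma> \<le> norm (grad f x)" "\<Delta> \<le> (1 - \<rho>\<^sub>1) * \<gamma> / (8 * L\<^sub>G)"
  shows "\<rho>\<^sub>1 \<le> tr_ratio f x \<xi> u"
proof -
  interpret S: subproblem "hess f x" "grad f x" \<xi> \<Delta> L\<^sub>G by fact
  have q: "S.q = tr_model f x" by (simp add: S.q_def tr_model_def fun_eq_iff)
  have \<Delta>L: "8 * L\<^sub>G * \<Delta> \<le> (1 - \<rho>\<^sub>1) * \<gamma>" using \<gamma>(3) L_pos by (simp add: field_simps)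
  have u: "norm u \<le> \<Delta>" "S.first_decrease \<le> tr_model f x \<xi> - tr_model f x u"
    using S.exit_bounds[OF ex] by (auto simp: q)
  have "(1 - \<rho>\<^sub>1) * \<gamma> \<le> \<gamma>" using \<rho>\<^sub>1 \<gamma> by (simp add: mult_left_le_one_le)
  then have "\<Delta> * L\<^sub>G \<le> \<gamma>" using \<Delta>L mult_pos_pos[OF S.\<Delta>_pos L_pos(2)] by (simp add: algebra_simps)
  then have dec: "\<gamma> * \<Delta> / 8 \<le> tr_model f x \<xi> - tr_model f x u"
    using S.large_gradient_decrease[of \<gamma>] \<gamma> u(2) by linarith
  show ?thesis
  proof (rule tr_ratio_ge)
    have "L\<^sub>G * (norm u)\<^sup>2 \<le> L\<^sub>G * \<Delta>\<^sup>2" using u L_pos by (intro mult_left_mono power_mono) auto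
    also have "\<dots> \<le> (1 - \<rho>\<^sub>1) * (\<gamma> * \<Delta> / 8)"
      using mult_right_mono[OF \<Delta>L, of "\<Delta> / 8"] S.\<Delta>_pos by (simp add: power2_eq_square algebra_simps)
    also have "\<dots> \<le> (1 - \<rho>\<^sub>1) * (tr_model f x \<xi> - tr_model f x u)"
      using dec \<rho>\<^sub>1 by (intro mult_left_mono) auto
    finally show "f (x + u) - f x - tr_model f x u \<le> (1 - \<rho>\<^sub>1) * (tr_model f x \<xi> - tr_model f x u)"
      using tr_model_error_quadratic[of x u] by linarith
    have "0 < \<gamma> * \<Delta> / 8" using \<gamma> S.\<Delta>_pos by simp
    then show "tr_model f x u < tr_model f x \<xi>" using dec by linarith
  qed
qed

lemma tr_ratio_ge_near_critical:
  assumes "subproblem (hess f x) (grad f x) \<xi> \<Delta> L\<^sub>G"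
    and ex: "subproblem.interior_exit (hess f x) (grad f x) \<xi> \<Delta> L\<^sub>G \<omega>\<^sub>1 \<omega>\<^sub>2 u \<or>
      subproblem.boundary_exit (hess f x) (grad f x) \<xi> \<Delta> L\<^sub>G u"
    and \<rho>\<^sub>1: "0 < \<rho>\<^sub>1" "\<rho>\<^sub>1 < 1" and \<omega>\<^sub>1: "\<omega>\<^sub>1 < 1"
    and res: "subproblem.res (hess f x) (grad f x) \<xi> \<noteq> 0"
    and crit: "morse \<mu> f" "0 < \<mu>" "critical_point f xb" "norm (x - xb) \<le> \<mu>\<^sup>2 / (4 * L\<^sub>H * L\<^sub>G)"
    and u: "norm u \<le> Delta_crit \<rho>\<^sub>1 \<mu> L\<^sub>H L\<^sub>G"
  shows "\<rho>\<^sub>1 \<le> tr_ratio f x \<xi> u"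
proof -
  interpret S: subproblem "hess f x" "grad f x" \<xi> \<Delta> L\<^sub>G by fact
  have q: "S.q = tr_model f x" by (simp add: S.q_def tr_model_def fun_eq_iff)
  have dec: "9 / 512 * \<mu>\<^sup>2 / L\<^sub>G * (norm u)\<^sup>2 \<le> tr_model f x \<xi> - tr_model f x u"
    using S.nonsingular_decrease[OF hess_nonsingular_near_critical[OF crit] crit(2)
        morse_le_lipschitz[OF crit(1,3)] \<omega>\<^sub>1 ex] by (simp add: q)
  have fst: "S.first_decrease \<le> tr_model f x \<xi> - tr_model f x u"
    using S.exit_bounds[OF ex] by (simp add: q)
  show ?thesis
  proof (rule tr_ratio_ge)
    have "L\<^sub>H / 6 * norm u ^ 3 = (L\<^sub>H / 6 * (norm u)\<^sup>2) * norm u"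
      by (simp add: power2_eq_square power3_eq_cube)
    also have "\<dots> \<le> (L\<^sub>H / 6 * (norm u)\<^sup>2) * Delta_crit \<rho>\<^sub>1 \<mu> L\<^sub>H L\<^sub>G"
      using u L_pos by (intro mult_left_mono) auto
    \<comment> \<open>1/60 is the 1/6 of the Taylor bound times the 1/10 of
      \<open>Delta_crit\<close>.\<close>
    also have "\<dots> = (1 - \<rho>\<^sub>1) * (1 / 60 * (\<mu>\<^sup>2 / L\<^sub>G * (norm u)\<^sup>2))"
      using L_pos by (simp add: Delta_crit_def field_simps)
    also have "\<dots> \<le> (1 - \<rho>\<^sub>1) * (9 / 512 * (\<mu>\<^sup>2 / L\<^sub>G * (norm u)\<^sup>2))"
      using \<rho>\<^sub>1 L_pos by (intro mult_left_mono mult_right_mono) auto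
    also have "\<dots> \<le> (1 - \<rho>\<^sub>1) * (tr_model f x \<xi> - tr_model f x u)"
      using dec \<rho>\<^sub>1 by (intro mult_left_mono) auto
    finally show "f (x + u) - f x - tr_model f x u \<le> (1 - \<rho>\<^sub>1) * (tr_model f x \<xi> - tr_model f x u)"
      using tr_model_error_cubic[of x u] by linarith
    \<comment> \<open>The bound \<open>dec\<close> is not strict when \<open>u = 0\<close>; the
      first step gives strictness.\<close>
    show "tr_model f x u < tr_model f x \<xi>" using fst S.first_decrease_pos[OF res] by linarith
  qed
qed

end

section \<open>Runs of the trust-region method\<close>

locale tr_run = cost f f_low L\<^sub>H L\<^sub>G
  for f :: "real^'n \<Rightarrow> real" and f_low L\<^sub>H L\<^sub>G +
  fixes \<mu> R\<^sub>s \<gamma>\<^sub>s \<omega>\<^sub>1 \<omega>\<^sub>2 \<rho>\<^sub>1 \<rho>\<^sub>2 \<Delta>\<^sub>m\<^sub>a\<^sub>x \<Delta>\<^sub>0 \<sigma> R :: real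
    and x\<^sub>0 :: "real^'n"
    and \<xi>b x \<xi> u :: "nat \<Rightarrow> real^'n"
    and \<Delta> \<rho> :: "nat \<Rightarrow> real"
    and stop :: "nat \<Rightarrow> stop_reason"
    and T :: "nat \<Rightarrow> nat"
  assumes B: "assumption_B f L\<^sub>H L\<^sub>G \<mu> R\<^sub>s \<gamma>\<^sub>s"
    and solver_params: "0 < \<omega>\<^sub>1" "\<omega>\<^sub>1 < 1" "0 < \<omega>\<^sub>2"
    and tr_params: "0 < \<rho>\<^sub>1" "\<rho>\<^sub>1 < \<rho>\<^sub>2" "\<rho>\<^sub>2 < 1"
    and input: "0 < 4 * \<sigma>" "4 * \<sigma> \<le> \<Delta>\<^sub>0" "\<Delta>\<^sub>0 \<le> \<Delta>\<^sub>m\<^sub>a\<^sub>x"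
    and run: "randomized_tr_run f \<omega>\<^sub>1 \<omega>\<^sub>2 \<rho>\<^sub>1 \<rho>\<^sub>2 \<Delta>\<^sub>m\<^sub>a\<^sub>x x\<^sub>0 \<Delta>\<^sub>0 \<sigma> \<xi>b x \<Delta> \<xi> u stop T \<rho>"
    and R: "R = R_bar \<rho>\<^sub>1 \<gamma>\<^sub>s \<mu> \<omega>\<^sub>2 L\<^sub>H L\<^sub>G \<Delta>\<^sub>0"
    and noise: "\<sigma> \<le> R"
begin

section \<open>Parameters and solver outputs along a run\<close>

lemma \<mu>_pos: "0 < \<mu>" and morse: "morse \<mu> f" and \<gamma>_pos: "0 < \<gamma>\<^sub>s"
  using B by (auto simp: assumption_B_def)

lemma strong_gradient_cases:
  "\<gamma>\<^sub>s \<le> norm (grad f y) \<or> (\<exists>xb. critical_point f xb \<and> norm (y - xb) \<le> \<mu>\<^sup>2 / (4 * L\<^sub>H * L\<^sub>G))"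
proof -
  have "R\<^sub>s \<le> \<mu>\<^sup>2 / (4 * L\<^sub>H * L\<^sub>G)" "strong_gradient R\<^sub>s \<gamma>\<^sub>s f"
    using B by (auto simp: assumption_B_def)
  then show ?thesis unfolding strong_gradient_def by (meson order_trans)
qed

lemma \<rho>\<^sub>1: "0 < \<rho>\<^sub>1" "\<rho>\<^sub>1 < 1"
  using tr_params by auto

text \<open>The terms of \<open>R_bar\<close> in the form used below, with 256 split as 32 times 8.
  The factor 32 allows one division of the radius by 4 to end above \<open>8 * R\<close>.\<close>

lemma R_le:
  "32 * R \<le> (1 - \<rho>\<^sub>1) * \<gamma>\<^sub>s / (8 * L\<^sub>G)" "8 * R * \<omega>\<^sub>2 * L\<^sub>G\<^sup>2 \<le> \<mu>"
  "32 * R \<le> Delta_crit \<rho>\<^sub>1 \<mu> L\<^sub>H L\<^sub>G" "8 * R \<le> \<Delta>\<^sub>0"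
proof -
  note le = Min4_le[of "(1 - \<rho>\<^sub>1) * \<gamma>\<^sub>s / (256 * L\<^sub>G)" "\<mu> / (8 * \<omega>\<^sub>2 * L\<^sub>G\<^sup>2)"
    "Delta_crit \<rho>\<^sub>1 \<mu> L\<^sub>H L\<^sub>G / 32" "\<Delta>\<^sub>0 / 8", folded R_bar_def R]
  show "32 * R \<le> (1 - \<rho>\<^sub>1) * \<gamma>\<^sub>s / (8 * L\<^sub>G)"
    using le(1) L_pos by (simp add: field_simps)
  show "8 * R * \<omega>\<^sub>2 * L\<^sub>G\<^sup>2 \<le> \<mu>"
    using le(2) L_pos solver_params by (simp add: field_simps)
  show "32 * R \<le> Delta_crit \<rho>\<^sub>1 \<mu> L\<^sub>H L\<^sub>G" "8 * R \<le> \<Delta>\<^sub>0"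
    using le(3,4) by auto
qed

lemma R_pos: "0 < R"
  using input noise by linarith

lemma run_step:
  "norm (\<xi> k) = \<bar>min \<sigma> (\<Delta> k / 4)\<bar>"
  "0 \<le> (hess f (x k) *v \<xi> k) \<bullet> grad f (x k)"
  "(u k, stop k, T k) = the (tcg_bg \<omega>\<^sub>1 \<omega>\<^sub>2 (hess f (x k)) (grad f (x k)) (\<Delta> k) (\<xi> k))"
  "\<rho> k = tr_ratio f (x k) (\<xi> k) (u k)"
  "x (Suc k) = (if \<rho>\<^sub>1 \<le> \<rho> k then x k + u k else x k)"
  "\<Delta> (Suc k) = tr_radius \<rho>\<^sub>1 \<rho>\<^sub>2 \<Delta>\<^sub>m\<^sub>a\<^sub>x (\<Delta> k) (\<rho> k) (stop k)"
proof -
  have *: "norm (\<xi>b k) = 1" "\<xi> k = min \<sigma> (\<Delta> k / 4) *\<^sub>R \<xi>b k \<or> \<xi> k = - (min \<sigma> (\<Delta> k / 4) *\<^sub>R \<xi>b k)"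
    using run by (auto simp: randomized_tr_run_def)
  then show "norm (\<xi> k) = \<bar>min \<sigma> (\<Delta> k / 4)\<bar>" by auto
qed (use run in \<open>auto simp: randomized_tr_run_def\<close>)

lemma subproblem_k:
  assumes "0 < \<Delta> k"
  shows "subproblem (hess f (x k)) (grad f (x k)) (\<xi> k) (\<Delta> k) L\<^sub>G"
  using assms run_step(1,2)[of k] input by (intro subproblem_at) auto

lemma noise_nonzero: "0 < \<Delta> k \<Longrightarrow> \<xi> k \<noteq> 0"
  using run_step(1)[of k] input by auto

text \<open>A zero residual would, by \<open>norm_res_start\<close>, make \<open>x k\<close>
  critical with the nonzero noise in the kernel of its Hessian, against the Morse property. So the
  solver never halts before its first iteration.\<close>

lemma res_noise_nonzero:
  assumes "0 < \<Delta> k"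
  shows "subproblem.res (hess f (x k)) (grad f (x k)) (\<xi> k) \<noteq> 0"
proof
  interpret S: subproblem "hess f (x k)" "grad f (x k)" "\<xi> k" "\<Delta> k" L\<^sub>G by (rule subproblem_k[OF assms])
  assume "S.res (\<xi> k) = 0"
  then have "(norm (grad f (x k)))\<^sup>2 + (norm (hess f (x k) *v \<xi> k))\<^sup>2 \<le> 0"
    using S.norm_res_start by simp
  then have *: "grad f (x k) = 0" "hess f (x k) *v \<xi> k = 0"
    by (simp_all add: sum_power2_le_zero_iff)
  then have "\<mu> * norm (\<xi> k) \<le> 0"
    using morse[unfolded morse_def critical_point_def, rule_format, OF *(1), of "\<xi> k"] by simp
  then show False using \<mu>_pos noise_nonzero[OF assms] by (simp add: mult_le_0_iff)
qed

text \<open>Termination turns \<open>the\<close> into an actual result, so the recorded outputs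
  inherit the exit conditions.\<close>

lemma solver_exit:
  assumes "0 < \<Delta> k"
  shows "tcg_bg \<omega>\<^sub>1 \<omega>\<^sub>2 (hess f (x k)) (grad f (x k)) (\<Delta> k) (\<xi> k) = Some (u k, stop k, T k)"
    "stop k = Residual \<Longrightarrow> subproblem.interior_exit (hess f (x k)) (grad f (x k)) (\<xi> k) (\<Delta> k) L\<^sub>G \<omega>\<^sub>1 \<omega>\<^sub>2 (u k)"
    "stop k = Boundary \<Longrightarrow> subproblem.boundary_exit (hess f (x k)) (grad f (x k)) (\<xi> k) (\<Delta> k) L\<^sub>G (u k)"
proof -
  interpret S: subproblem "hess f (x k)" "grad f (x k)" "\<xi> k" "\<Delta> k" L\<^sub>G by (rule subproblem_k[OF assms])
  obtain u' st T' where *: "tcg_bg \<omega>\<^sub>1 \<omega>\<^sub>2 (hess f (x k)) (grad f (x k)) (\<Delta> k) (\<xi> k) = Some (u', st, T')"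
    "st = Residual \<Longrightarrow> S.interior_exit \<omega>\<^sub>1 \<omega>\<^sub>2 u'" "st = Boundary \<Longrightarrow> S.boundary_exit u'"
    using S.tcg_bg_terminates[OF solver_params(1,3) res_noise_nonzero[OF assms]] by metis
  moreover have "u' = u k" "st = stop k" "T' = T k" using run_step(3)[of k] *(1) by auto
  ultimately show "tcg_bg \<omega>\<^sub>1 \<omega>\<^sub>2 (hess f (x k)) (grad f (x k)) (\<Delta> k) (\<xi> k) = Some (u k, stop k, T k)"
    "stop k = Residual \<Longrightarrow> S.interior_exit \<omega>\<^sub>1 \<omega>\<^sub>2 (u k)" "stop k = Boundary \<Longrightarrow> S.boundary_exit (u k)"
    by auto
qed

lemma solver_exit_cases:
  assumes "0 < \<Delta> k"
  shows "subproblem.interior_exit (hess f (x k)) (grad f (x k)) (\<xi> k) (\<Delta> k) L\<^sub>G \<omega>\<^sub>1 \<omega>\<^sub>2 (u k) \<or>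
    subproblem.boundary_exit (hess f (x k)) (grad f (x k)) (\<xi> k) (\<Delta> k) L\<^sub>G (u k)"
  using solver_exit(2,3)[OF assms] by (cases "stop k") auto

lemma norm_step_le:
  assumes "0 < \<Delta> k"
  shows "norm (u k) \<le> \<Delta> k"
proof -
  interpret S: subproblem "hess f (x k)" "grad f (x k)" "\<xi> k" "\<Delta> k" L\<^sub>G by (rule subproblem_k[OF assms])
  show ?thesis by (rule S.exit_bounds(1)[OF solver_exit_cases[OF assms]])
qed

section \<open>Lower bound on the radius\<close>

lemma successful_if_small_radius:
  assumes "0 < \<Delta> k" "\<Delta> k \<le> 32 * R"
  shows "\<rho>\<^sub>1 \<le> \<rho> k"
proof -
  note ex = solver_exit_cases[OF assms(1)] and sub = subproblem_k[OF assms(1)]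
  consider "\<gamma>\<^sub>s \<le> norm (grad f (x k))"
    | xb where "critical_point f xb" "norm (x k - xb) \<le> \<mu>\<^sup>2 / (4 * L\<^sub>H * L\<^sub>G)"
    using strong_gradient_cases[of "x k"] by blast
  then show ?thesis
    unfolding run_step(4)
  proof cases
    case 1
    have "\<Delta> k \<le> (1 - \<rho>\<^sub>1) * \<gamma>\<^sub>s / (8 * L\<^sub>G)" using assms(2) R_le(1) by (rule order_trans)
    then show "\<rho>\<^sub>1 \<le> tr_ratio f (x k) (\<xi> k) (u k)"
      by (rule tr_ratio_ge_large_gradient[OF sub ex \<rho>\<^sub>1 \<gamma>_pos 1])
  next
    case 2
    have "norm (u k) \<le> Delta_crit \<rho>\<^sub>1 \<mu> L\<^sub>H L\<^sub>G"
      using norm_step_le[OF assms(1)] assms(2) R_le(3) by linarith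
    then show "\<rho>\<^sub>1 \<le> tr_ratio f (x k) (\<xi> k) (u k)"
      by (rule tr_ratio_ge_near_critical[OF sub ex \<rho>\<^sub>1 solver_params(2) res_noise_nonzero[OF assms(1)]
            morse \<mu>_pos 2])
  qed
qed

text \<open>Below \<open>32 R\<close> every iteration is successful, so a division by \<open>4\<close> never leads below \<open>8 R\<close>.\<close>

lemma radius_ge: "8 * R \<le> \<Delta> k"
proof (induction k)
  case 0
  then show ?case using R_le(4) run by (simp add: randomized_tr_run_def)
next
  case (Suc k)
  then have "0 < \<Delta> k" using R_pos by linarith
  then have "\<rho> k < \<rho>\<^sub>1 \<Longrightarrow> 32 * R < \<Delta> k"
    using successful_if_small_radius[of k] by linarith
  moreover have "8 * R \<le> \<Delta>\<^sub>m\<^sub>a\<^sub>x" using R_le(4) input by linarith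
  ultimately show ?case
    using Suc \<open>0 < \<Delta> k\<close> unfolding run_step(6) by (auto simp: tr_radius_def)
qed

lemma radius_pos: "0 < \<Delta> k"
  using radius_ge[of k] R_pos by linarith

section \<open>One iteration near a local minimizer\<close>

lemma local_step:
  assumes minimizer: "local_minimizer f xs" and close: "norm (x k - xs) \<le> R"
  shows "stop k = Residual" "\<rho>\<^sub>1 \<le> \<rho> k" "\<Delta> (Suc k) = \<Delta> k"
    "norm (x (Suc k) - xs) \<le> (norm (x k - xs))\<^sup>2 / (2 * R)"
proof -
  let ?H = "hess f (x k)" and ?g = "grad f (x k)" and ?e = "x k - xs"
  interpret S: subproblem ?H ?g "\<xi> k" "\<Delta> k" L\<^sub>G by (rule subproblem_k[OF radius_pos])
  have crit: "critical_point f xs" using grad_local_minimizer[OF minimizer] by (simp add: critical_point_def)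
  have \<mu>L: "\<mu> \<le> L\<^sub>G" using morse_le_lipschitz[OF morse crit] .
  \<comment> \<open>320 is 32 times the 10 in \<open>Delta_crit\<close>, after bounding
    \<open>1 - \<rho>\<^sub>1\<close> by 1.\<close>
  have R_small: "R \<le> \<mu>\<^sup>2 / (320 * L\<^sub>H * L\<^sub>G)"
  proof -
    have "(1 - \<rho>\<^sub>1) * (\<mu>\<^sup>2 / (10 * L\<^sub>H * L\<^sub>G)) \<le> 1 * (\<mu>\<^sup>2 / (10 * L\<^sub>H * L\<^sub>G))"
      using \<rho>\<^sub>1 L_pos by (intro mult_right_mono) auto
    then show ?thesis using R_le(3) by (simp add: Delta_crit_def)
  qed
  have LR: "320 * (L\<^sub>H * R) \<le> \<mu>"
  proof -
    have "320 * L\<^sub>H * L\<^sub>G * R \<le> \<mu> * \<mu>" using R_small L_pos by (simp add: field_simps power2_eq_square)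
    also have "\<dots> \<le> \<mu> * L\<^sub>G" using \<mu>L \<mu>_pos by (intro mult_left_mono) auto
    finally show ?thesis using L_pos by (simp add: field_simps)
  qed
  \<comment> \<open>Moving from \<open>xs\<close> to \<open>x k\<close> costs at most
    \<open>L\<^sub>H * R \<le> \<mu> / 320\<close> of the curvature.\<close>
  have pd: "319 / 320 * \<mu> * (norm w)\<^sup>2 \<le> w \<bullet> (?H *v w)" for w
  proof -
    have "- (w \<bullet> (?H *v w - hess f xs *v w)) \<le> norm w * norm (?H *v w - hess f xs *v w)"
      using Cauchy_Schwarz_ineq2[of w "?H *v w - hess f xs *v w"] by linarith
    also have "\<dots> \<le> norm w * (L\<^sub>H * R * norm w)"
      by (intro mult_left_mono hess_near close) auto
    also have "\<dots> = L\<^sub>H * R * (norm w)\<^sup>2" by (simp add: power2_eq_square)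
    also have "\<dots> \<le> \<mu> / 320 * (norm w)\<^sup>2" using LR by (intro mult_right_mono) auto
    finally show ?thesis
      using hess_local_minimizer_pd[OF minimizer morse \<mu>_pos, of w] by (simp add: inner_diff_right)
  qed
  have ns: "319 / 320 * \<mu> * norm w \<le> norm (?H *v w)" for w
  proof (cases "w = 0")
    case False
    have "norm w * (319 / 320 * \<mu> * norm w) = 319 / 320 * \<mu> * (norm w)\<^sup>2"
      by (simp add: power2_eq_square)
    also have "\<dots> \<le> norm w * norm (?H *v w)"
      using pd norm_cauchy_schwarz by (rule order_trans)
    finally have "norm w * (319 / 320 * \<mu> * norm w) \<le> norm w * norm (?H *v w)" .
    then show ?thesis using False by simp
  qed simp
  have pos: "0 < w \<bullet> (?H *v w)" if "w \<noteq> 0" for w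
  proof -
    have "0 < 319 / 320 * \<mu> * (norm w)\<^sup>2" using that \<mu>_pos by simp
    then show ?thesis using pd[of w] by linarith
  qed
  \<comment> \<open>Linearized at \<open>x k\<close>, where the Newton equation is posed; the
    gradient at \<open>xs\<close> vanishes.\<close>
  have lin: "norm (?g - ?H *v ?e) \<le> L\<^sub>H * norm ?e * norm ?e"
    using grad_linearization[of xs "x k" "norm ?e" "x k"] grad_local_minimizer[OF minimizer]
    by (simp add: norm_minus_commute)
  have "inj ((*v) ?H)"
  proof (rule injI)
    fix a b assume "?H *v a = ?H *v b"
    then have "?H *v (a - b) = 0" by (simp add: matrix_vector_mult_diff_distrib)
    then show "a = b" using pos[of "a - b"] by force
  qed
  then have "surj ((*v) ?H)"
    by (intro linear_injective_imp_surjective[OF matrix_vector_mul_linear]) auto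
  then obtain vs where vs: "?H *v vs = - ?g" by (metis surjD)
  then have newton: "S.res vs = 0" by (simp add: S.res_def)
  \<comment> \<open>\<open>vs + ?e\<close> is the error of the exact Newton iterate; the estimate
    yields \<open>R / 319\<close>, rounded up.\<close>
  have "norm (vs + ?e) \<le> R / 300"
  proof -
    have "319 / 320 * \<mu> * norm (vs + ?e) \<le> norm (?H *v (vs + ?e))" by (rule ns)
    also have "\<dots> = norm (?g - ?H *v ?e)"
      by (simp add: matrix_vector_right_distrib vs norm_minus_commute)
    also have "\<dots> \<le> L\<^sub>H * norm ?e * norm ?e" by (rule lin)
    also have "\<dots> \<le> L\<^sub>H * R * R" using close L_pos R_pos by (intro mult_mono) auto
    also have "\<dots> \<le> \<mu> / 320 * R" using LR R_pos by (intro mult_right_mono) auto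
    finally have "\<mu> * (319 * norm (vs + ?e)) \<le> \<mu> * R" by simp
    then show ?thesis using \<mu>_pos R_pos by simp
  qed
  then have vs_le: "norm vs \<le> 301 / 300 * R"
    using norm_triangle_ineq4[of "vs + ?e" ?e] close by simp
  have \<xi>_le: "norm (\<xi> k) \<le> R"
    using run_step(1)[of k] noise input radius_pos[of k] by auto
  \<comment> \<open>The sum is at most \<open>norm vs + 2 * norm (\<xi> k)\<close>, slightly above
    \<open>3 * R\<close> at worst, while \<open>radius_ge\<close> gives
    \<open>4 * R \<le> \<Delta> k / 2\<close>.\<close>
  have far: "norm (vs - \<xi> k) + norm (\<xi> k) < 4 * R"
    using norm_triangle_ineq4[of vs "\<xi> k"] \<xi>_le vs_le R_pos by linarith
  have "\<not> S.boundary_exit (u k)"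
    using far radius_ge[of k] by (intro S.not_boundary_exit[OF pos newton]) auto
  then show res: "stop k = Residual"
    using solver_exit(3)[OF radius_pos] by (cases "stop k") auto
  then have ex: "S.interior_exit \<omega>\<^sub>1 \<omega>\<^sub>2 (u k)" using solver_exit(2)[OF radius_pos] by blast
  note u = S.interior_exitD[OF ex]
  have "norm (u k - \<xi> k) \<le> norm (vs - \<xi> k)"
    by (rule S.interior_exit_norm_le[OF pos newton ex])
  then have u_le: "norm (u k) \<le> 4 * R"
    using far norm_triangle_ineq[of "u k - \<xi> k" "\<xi> k"] by simp
  have "\<mu>\<^sup>2 / (320 * L\<^sub>H * L\<^sub>G) \<le> \<mu>\<^sup>2 / (4 * L\<^sub>H * L\<^sub>G)"
    using L_pos by (intro divide_left_mono) auto
  then have near: "norm ?e \<le> \<mu>\<^sup>2 / (4 * L\<^sub>H * L\<^sub>G)"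
    using close R_small by linarith
  show \<rho>k: "\<rho>\<^sub>1 \<le> \<rho> k"
    unfolding run_step(4)
    using u_le R_le(3) R_pos
    by (intro tr_ratio_ge_near_critical[OF S.subproblem_axioms disjI1[OF ex] \<rho>\<^sub>1 solver_params(2)
        res_noise_nonzero[OF radius_pos] morse \<mu>_pos crit near]) linarith
  then show "\<Delta> (Suc k) = \<Delta> k" using res run_step(6)[of k] by (simp add: tr_radius_def)
  have g_le: "norm ?g \<le> L\<^sub>G * norm ?e"
    using grad_lipschitz[of "x k" xs] grad_local_minimizer[OF minimizer] by simp
  \<comment> \<open>The Newton estimate again, now for \<open>?e + u k\<close>, the error after the
    step, with the solver residual as an additional term.\<close>
  have "319 / 320 * \<mu> * norm (?e + u k) \<le> norm (?H *v (?e + u k))" by (rule ns)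
  also have "\<dots> = norm ((?H *v ?e - ?g) - S.res (u k))"
    by (simp add: S.res_def matrix_vector_right_distrib algebra_simps)
  also have "\<dots> \<le> norm (?g - ?H *v ?e) + norm (S.res (u k))"
    by (metis norm_minus_commute norm_triangle_ineq4)
  also have "\<dots> \<le> L\<^sub>H * norm ?e * norm ?e + \<omega>\<^sub>2 * (norm ?g)\<^sup>2"
    using lin u(4) by (rule add_mono)
  also have "\<dots> \<le> L\<^sub>H * norm ?e * norm ?e + \<omega>\<^sub>2 * (L\<^sub>G * norm ?e)\<^sup>2"
    using g_le solver_params by (intro add_left_mono mult_left_mono power_mono) auto
  also have "\<dots> = (L\<^sub>H + \<omega>\<^sub>2 * L\<^sub>G\<^sup>2) * (norm ?e)\<^sup>2" by (simp add: power2_eq_square algebra_simps)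
  finally have "(319 / 320 * \<mu> * norm (?e + u k)) * (2 * R) \<le> ((L\<^sub>H + \<omega>\<^sub>2 * L\<^sub>G\<^sup>2) * (norm ?e)\<^sup>2) * (2 * R)"
    using R_pos by (intro mult_right_mono) auto
  also have "\<dots> = (2 * (L\<^sub>H * R) + 2 * R * \<omega>\<^sub>2 * L\<^sub>G\<^sup>2) * (norm ?e)\<^sup>2" by (simp add: algebra_simps)
  \<comment> \<open>The two summands are at most \<open>\<mu> / 160\<close> and
    \<open>\<mu> / 4\<close>.\<close>
  also have "\<dots> \<le> (319 / 320 * \<mu>) * (norm ?e)\<^sup>2"
    using LR R_le(2) \<mu>_pos by (intro mult_right_mono) auto
  finally have "\<mu> * (norm (?e + u k) * (2 * R)) \<le> \<mu> * (norm ?e)\<^sup>2" by (simp add: mult_ac)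
  then have "norm (?e + u k) \<le> (norm ?e)\<^sup>2 / (2 * R)"
    using \<mu>_pos R_pos by (simp add: field_simps)
  then show "norm (x (Suc k) - xs) \<le> (norm ?e)\<^sup>2 / (2 * R)"
    using \<rho>k run_step(5)[of k] by (simp add: algebra_simps)
qed

end

section \<open>Quadratic convergence\<close>

lemma quadratic_contraction:
  fixes y :: "nat \<Rightarrow> real^'n"
  assumes R: "0 < R" and close: "norm (y 0 - l) \<le> R"
    and step: "\<And>i. norm (y i - l) \<le> R \<Longrightarrow> norm (y (Suc i) - l) \<le> (norm (y i - l))\<^sup>2 / (2 * R)"
  shows "norm (y i - l) \<le> R"
    "converges_at_least_quadratically y l"
proof -
  \<comment> \<open>Halving the error keeps every iterate within \<open>R\<close>, so the
    conditional hypothesis \<open>step\<close> applies at each index.\<close>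
  have half: "norm (y i - l) \<le> R * (1 / 2) ^ i \<and> norm (y i - l) \<le> R" for i
  proof (induction i)
    case (Suc i)
    have "norm (y (Suc i) - l) \<le> norm (y i - l) * norm (y i - l) / (2 * R)"
      using step Suc by (simp add: power2_eq_square)
    also have "\<dots> \<le> norm (y i - l) * R / (2 * R)"
      using Suc R by (intro divide_right_mono mult_left_mono) auto
    finally have "norm (y (Suc i) - l) \<le> norm (y i - l) / 2" using R by simp
    then show ?case using Suc norm_ge_zero[of "y i - l"] by (auto simp del: norm_ge_zero)
  qed (use close in simp)
  then show "norm (y i - l) \<le> R" by auto
  have "(\<lambda>i. R * (1 / 2) ^ i) \<longlonglongrightarrow> 0"
    by (intro tendsto_mult_right_zero LIMSEQ_power_zero) simp
  moreover have "\<forall>\<^sub>F i in sequentially. norm (y i - l) \<le> R * (1 / 2) ^ i"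
    using half by simp
  ultimately have "(\<lambda>i. y i - l) \<longlonglongrightarrow> 0" by (rule Lim_null_comparison[rotated])
  then have "y \<longlonglongrightarrow> l" by (simp add: LIM_zero_cancel)
  moreover have "norm (y (Suc i) - l) \<le> 1 / (2 * R) * (norm (y i - l))\<^sup>2" for i
    using step half[of i] by simp
  ultimately show "converges_at_least_quadratically y l"
    unfolding converges_at_least_quadratically_def
    by (intro conjI exI[of _ "1 / (2 * R)"] always_eventually allI)
qed

theorem proposition6p7:
  fixes f :: "real^'n \<Rightarrow> real"
    and f_low L\<^sub>H L\<^sub>G \<mu> R\<^sub>s \<gamma>\<^sub>s \<omega>\<^sub>1 \<omega>\<^sub>2 \<rho>\<^sub>1 \<rho>\<^sub>2 \<Delta>\<^sub>m\<^sub>a\<^sub>x \<Delta>\<^sub>0 \<sigma> R :: real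
    and x\<^sub>0 xs :: "real^'n"
    and \<xi>b x \<xi> u :: "nat \<Rightarrow> real^'n"
    and \<Delta> \<rho> :: "nat \<Rightarrow> real"
    and stop :: "nat \<Rightarrow> stop_reason"
    and T :: "nat \<Rightarrow> nat"
    and k :: nat
  assumes A: "assumption_A f f_low L\<^sub>H L\<^sub>G"
    and B: "assumption_B f L\<^sub>H L\<^sub>G \<mu> R\<^sub>s \<gamma>\<^sub>s"
    and solver_params: "0 < \<omega>\<^sub>1" "\<omega>\<^sub>1 < 1" "0 < \<omega>\<^sub>2"
    and tr_params: "0 < \<Delta>\<^sub>m\<^sub>a\<^sub>x" "0 < \<rho>\<^sub>1" "\<rho>\<^sub>1 < \<rho>\<^sub>2" "\<rho>\<^sub>2 < 1"
    and input: "0 < 4 * \<sigma>" "4 * \<sigma> \<le> \<Delta>\<^sub>0" "\<Delta>\<^sub>0 \<le> \<Delta>\<^sub>m\<^sub>a\<^sub>x"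
    and run: "randomized_tr_run f \<omega>\<^sub>1 \<omega>\<^sub>2 \<rho>\<^sub>1 \<rho>\<^sub>2 \<Delta>\<^sub>m\<^sub>a\<^sub>x x\<^sub>0 \<Delta>\<^sub>0 \<sigma> \<xi>b x \<Delta> \<xi> u stop T \<rho>"
    and R: "R = R_bar \<rho>\<^sub>1 \<gamma>\<^sub>s \<mu> \<omega>\<^sub>2 L\<^sub>H L\<^sub>G \<Delta>\<^sub>0"
    and noise: "\<sigma> \<le> R"
    and minimizer: "local_minimizer f xs"
    and close: "norm (x k - xs) \<le> R"
  shows "(tcg_bg \<omega>\<^sub>1 \<omega>\<^sub>2 (hess f (x k)) (grad f (x k)) (\<Delta> k) (\<xi> k) = Some (u k, stop k, T k) \<and>
          stop k = Residual) \<and>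
         (\<rho>\<^sub>1 \<le> \<rho> k \<and> \<Delta> (Suc k) = \<Delta> k) \<and>
         (norm (x (Suc k) - xs) \<le> (norm (x k - xs))\<^sup>2 / (2 * R) \<and>
          (norm (x k - xs))\<^sup>2 / (2 * R) \<le> R / 2) \<and>
         (\<forall>j\<ge>k. norm (x j - xs) \<le> R) \<and>
         converges_at_least_quadratically (\<lambda>i. x (k + i)) xs"
proof -
  interpret tr_run f f_low L\<^sub>H L\<^sub>G \<mu> R\<^sub>s \<gamma>\<^sub>s \<omega>\<^sub>1 \<omega>\<^sub>2 \<rho>\<^sub>1 \<rho>\<^sub>2 \<Delta>\<^sub>m\<^sub>a\<^sub>x \<Delta>\<^sub>0 \<sigma> R x\<^sub>0 \<xi>b x \<xi> u \<Delta> \<rho> stop T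
    by unfold_locales (use assms in auto)
  have "(norm (x k - xs))\<^sup>2 / (2 * R) \<le> R\<^sup>2 / (2 * R)"
    using close R_pos by (intro divide_right_mono power_mono) auto
  also have "\<dots> = R / 2" using R_pos by (simp add: power2_eq_square)
  finally have half: "(norm (x k - xs))\<^sup>2 / (2 * R) \<le> R / 2" .
  \<comment> \<open>The radius bound holds at every iteration, so closeness alone carries the local
    step to later indices.\<close>
  have step: "norm (x (k + Suc i) - xs) \<le> (norm (x (k + i) - xs))\<^sup>2 / (2 * R)"
    if "norm (x (k + i) - xs) \<le> R" for i
    using local_step(4)[OF minimizer that] by simp
  have close0: "norm (x (k + 0) - xs) \<le> R" using close by simp
  note conv = quadratic_contraction[of R "\<lambda>i. x (k + i)" xs, OF R_pos close0 step]
  have "\<forall>j\<ge>k. norm (x j - xs) \<le> R" using conv(1) by (metis le_add_diff_inverse)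
  then show ?thesis
    using local_step[OF minimizer close] solver_exit(1)[OF radius_pos] half conv(2) by blast
qed

end
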